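(* Let $A\in\mathbb{R}^{n\times m}$ satisfy $A=XZY^T$, where $X\in\mathbb{R}^{n\times k}$, $Z\in\mathbb{R}^{k\times k}$, $Y\in\mathbb{R}^{m\times k}$ all have rank exactly $k$. Assume that $Z=\mathrm{blkdiag}(Z_1,Z_2,Z_3)$ with $Z_i\in\mathbb{R}^{k_i\times k_i}$, $k_1+k_2+k_3=k$, and that $X=\begin{bmatrix}X_1&X_2&X_3\end{bmatrix}$, $Y=\begin{bmatrix}Y_1&Y_2&Y_3\end{bmatrix}$ with $X_i\in\mathbb{R}^{n\times k_i}$, $Y_i\in\mathbb{R}^{m\times k_i}$. Assume further that $\begin{bmatrix}X_1&X_2\end{bmatrix}$ and $\begin{bmatrix}Y_1&Y_3\end{bmatrix}$ have orthonormal columns and are $\mu$-coherent, and that each column of $X_3$ and of $Y_2$ has at most $\beta$ nonzero entries. Run the randomized sRRQR row and column selection algorithm (described in the context) on $A$ with parameters $$\ell_0=\alpha\mu k,\qquad \ell_a=k,\qquad \ell_b=\alpha\mu k .$$ Then the returned row index set $I$ and column index set $J$ satisfy $$A=A(:,J)A(:,J)^\dagger\,A\,A(I,:)^\dagger A(I,:)$$ with probability at least $$1-\left(\frac{\beta\ell k}{n}+\frac{\beta\ell k}{m}+2ke^{-\alpha}\right),$$ where $\ell=\max\{\ell_0,\ell_a,\ell_b\}=\alpha\mu k$.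
   Context: Notation: $M^\dagger$ is the Moore-Penrose pseudoinverse; $A(I,:)$ and $A(:,J)$ are the submatrices of $A$ with rows indexed by $I$, respectively columns indexed by $J$; $\sigma_i$ is the $i$-th largest singular value; $\|\cdot\|_{\max}$ is the maximum absolute value of the entries. Coherence: a matrix $U\in\mathbb{R}^{n\times r}$ with orthonormal columns is $\mu$-coherent if $\mu=n\|U\|_{\max}^2$ (with $n$ the number of rows of $U$). Strong rank-revealing QR (sRRQR), with parameter $\eta=1$: a rank-$r$ sRRQR factorization of $M\in\mathbb{R}^{p\times q}$ is $MP=Q\begin{bmatrix}A_r&B_r\\0&C_r\end{bmatrix}$ with $P$ a permutation matrix, $Q$ orthogonal, $A_r\in\mathbb{R}^{r\times r}$, such that (a) $\sigma_i(A_r)\ge\sigma_i(M)/\sqrt{1+r(q-r)}$ for $1\le i\le r$; (b) $\sigma_j(C_r)\le\sigma_{r+j}(M)\sqrt{1+r(q-r)}$ for $1\le j\le \min\{p,q\}-r$; (c) $\|A_r^{-1}B_r\|_{\max}\le1$ (when $A_r$ is invertible). "Selecting $r$ columns of $M$ by sRRQR" means taking the indices of the $r$ columns of $M$ that are moved to the first $r$ positions by $P$. It is assumed that the sRRQR implementation, when given a zero residual matrix (i.e. when the already selected columns span the range of $M$ and fewer than $r$ columns have been selected), selects the remaining pivots uniformly at random among the remaining columns. Randomized sRRQR row and column selection algorithm, with input $A\in\mathbb{R}^{n\times m}$ and integers $\ell_0,\ell_a,\ell_b$: 1. Select $\ell_0$ row indices $I_0\subset\{1,\dots,n\}$ uniformly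 at random (without replacement). 2. Select $\ell_a$ columns of $A(I_0,:)$ by sRRQR (index set $J_a$). 3. Select $\ell_b$ further column indices $J_b\subset\{1,\dots,m\}$ uniformly at random (without replacement). 4. Select $\ell_0$ column indices $J_0\subset\{1,\dots,m\}$ of $A$ uniformly at random (without replacement). 5. Select $\ell_a$ columns of $A(:,J_0)^T$ by sRRQR (index set $I_a$ of rows of $A$). 6. Select $\ell_b$ further row indices $I_b\subset\{1,\dots,n\}$ uniformly at random (without replacement). 7. Return $J=(J_a,J_b)$ and $I=(I_a,I_b)$. The random selections in steps 1, 3, 4, 6 are independent. The quantities prescribed for $\ell_0,\ell_a,\ell_b$ are understood to be integers, and $\alpha>0$ is a real parameter. *)

theory Defs
  imports
    "HOL-Probability.Probability_Mass_Function"
    "HOL-Combinatorics.Permutations"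
    "HOL-Library.Monad_Syntax"
    "Jordan_Normal_Form.DL_Rank"
    "Jordan_Normal_Form.DL_Submatrix"
    "Jordan_Normal_Form.Char_Poly"
begin

abbreviation mrank :: "real mat \<Rightarrow> nat" where
  "mrank M \<equiv> vec_space.rank (dim_row M) M"

definition hcat :: "'a mat \<Rightarrow> 'a mat \<Rightarrow> 'a mat" where
  "hcat A B = mat (dim_row A) (dim_col A + dim_col B)
     (\<lambda>(i, j). if j < dim_col A then A $$ (i, j) else B $$ (i, j - dim_col A))"

abbreviation rows_of :: "'a mat \<Rightarrow> nat set \<Rightarrow> 'a mat" where
  "rows_of A I \<equiv> submatrix A I UNIV"

abbreviation cols_of :: "'a mat \<Rightarrow> nat set \<Rightarrow> 'a mat" where
  "cols_of A J \<equiv> submatrix A UNIV J"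

text \<open>The maximum over the entries of an empty matrix is read as \<open>0\<close>.\<close>

definition max_norm :: "real mat \<Rightarrow> real" where
  "max_norm M = Max (insert 0 (abs ` elements_mat M))"

definition is_pinv :: "real mat \<Rightarrow> real mat \<Rightarrow> bool" where
  "is_pinv A B \<longleftrightarrow>
     B \<in> carrier_mat (dim_col A) (dim_row A) \<and>
     A * B * A = A \<and> B * A * B = B \<and>
     transpose_mat (A * B) = A * B \<and> transpose_mat (B * A) = B * A"

definition pinv :: "real mat \<Rightarrow> real mat" where
  "pinv A = (THE B. is_pinv A B)"

text \<open>
  The singular values are the square roots of the eigenvalues of \<open>M\<^sup>T M\<close>, counted with
  multiplicity. For a matrix with fewer rows than columns, the list below is padded with zeros
  up to the number of columns. In \<open>singular_value M i\<close> the index \<open>i\<close> starts at \<open>1\<close>.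
\<close>

definition singular_values :: "real mat \<Rightarrow> real list" where
  "singular_values M =
     rev (sorted_list_of_multiset (image_mset sqrt (proots (char_poly (transpose_mat M * M)))))"

definition singular_value :: "real mat \<Rightarrow> nat \<Rightarrow> real" where
  "singular_value M i = singular_values M ! (i - 1)"

text \<open>The library predicate \<^const>\<open>orthogonal_mat\<close> does not ask for columns of unit length.\<close>

definition orthonormal_cols :: "real mat \<Rightarrow> bool" where
  "orthonormal_cols U \<longleftrightarrow> transpose_mat U * U = 1\<^sub>m (dim_col U)"

text \<open>
  Used for matrices \<open>U\<close> with orthonormal columns. A matrix without columns has no entries and
  is coherent for every parameter.
\<close>

definition coherent :: "real \<Rightarrow> real mat \<Rightarrow> bool" where
  "coherent \<mu> U \<longleftrightarrow> (dim_col U > 0 \<longrightarrow> \<mu> = real (dim_row U) * (max_norm U)\<^sup>2)"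

text \<open>Column \<open>j\<close> of \<open>M * perm_matrix q \<pi>\<close> is column \<open>\<pi> j\<close> of \<open>M\<close>.\<close>

definition perm_matrix :: "nat \<Rightarrow> (nat \<Rightarrow> nat) \<Rightarrow> real mat" where
  "perm_matrix q \<pi> = mat q q (\<lambda>(i, j). if i = \<pi> j then 1 else 0)"

text \<open>
  \<open>srrqr M r \<pi> Q Ar Br Cr\<close>: a strong rank-revealing QR factorization of rank \<open>r\<close>
  with parameter \<open>\<eta> = 1\<close>.
\<close>

definition srrqr ::
    "real mat \<Rightarrow> nat \<Rightarrow> (nat \<Rightarrow> nat) \<Rightarrow> real mat \<Rightarrow> real mat \<Rightarrow> real mat \<Rightarrow> real mat \<Rightarrow> bool" where
  "srrqr M r \<pi> Q Ar Br Cr \<longleftrightarrow>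
     (let p = dim_row M; q = dim_col M in
        r \<le> min p q \<and> \<pi> permutes {..<q} \<and>
        Q \<in> carrier_mat p p \<and> orthonormal_cols Q \<and>
        Ar \<in> carrier_mat r r \<and> Br \<in> carrier_mat r (q - r) \<and> Cr \<in> carrier_mat (p - r) (q - r) \<and>
        M * perm_matrix q \<pi> = Q * four_block_mat Ar Br (0\<^sub>m (p - r) r) Cr \<and>
        (\<forall>i\<in>{1..r}. singular_value Ar i \<ge> singular_value M i / sqrt (1 + real (r * (q - r)))) \<and>
        (\<forall>j\<in>{1..min p q - r}.
           singular_value Cr j \<le> singular_value M (r + j) * sqrt (1 + real (r * (q - r)))) \<and>
        (\<forall>Ainv. inverts_mat Ar Ainv \<and> inverts_mat Ainv Ar \<longrightarrow> max_norm (Ainv * Br) \<le> 1))"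

definition srrqr_columns :: "real mat \<Rightarrow> nat \<Rightarrow> nat set \<Rightarrow> bool" where
  "srrqr_columns M r S \<longleftrightarrow> (\<exists>\<pi> Q Ar Br Cr. srrqr M r \<pi> Q Ar Br Cr \<and> S = \<pi> ` {..<r})"

definition uniform_subset :: "nat set \<Rightarrow> nat \<Rightarrow> nat set pmf" where
  "uniform_subset D l = pmf_of_set {S. S \<subseteq> D \<and> card S = l}"

text \<open>
  A (possibly randomized) implementation \<open>sel\<close> of column selection by strong rank-revealing QR:
  every set of columns that \<open>sel M r\<close> can return comes from a factorization of rank \<open>r\<close>. The
  residual vanishes as soon as the selected columns span the range of \<open>M\<close>; each pivot up to that
  point raises the rank by one, so it happens after \<open>mrank M\<close> pivots. If this is fewer than
  \<open>r\<close>, the pivots still missing are uniformly distributed over the remaining columns. Nothing is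
  required when \<open>r > min p q\<close>, where no factorization exists.
\<close>

definition srrqr_implementation :: "(real mat \<Rightarrow> nat \<Rightarrow> nat set pmf) \<Rightarrow> bool" where
  "srrqr_implementation sel \<longleftrightarrow>
     (\<forall>M r. r \<le> min (dim_row M) (dim_col M) \<longrightarrow>
        (\<forall>S\<in>set_pmf (sel M r). srrqr_columns M r S) \<and>
        (mrank M < r \<longrightarrow>
           (\<exists>core.
              (\<forall>S\<in>set_pmf core. S \<subseteq> {..<dim_col M} \<and> card S = mrank M \<and>
                 mrank (cols_of M S) = mrank M) \<and>
              sel M r =
                do { S \<leftarrow> core;
                     T \<leftarrow> uniform_subset ({..<dim_col M} - S) (r - card S);
                     return_pmf (S \<union> T) })))"

text \<open>
  The joint distribution of the returned pair \<open>(I, J)\<close> of row and column index sets. Rows and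
  columns are numbered from \<open>0\<close>. The sets \<open>Jb\<close> and \<open>Ib\<close> are drawn from all indices,
  independently of \<open>Ja\<close> and \<open>Ia\<close>, and may overlap with them.
\<close>

definition rand_srrqr ::
    "(real mat \<Rightarrow> nat \<Rightarrow> nat set pmf) \<Rightarrow> real mat \<Rightarrow> nat \<Rightarrow> nat \<Rightarrow> nat \<Rightarrow> (nat set \<times> nat set) pmf" where
  "rand_srrqr sel A l0 la lb =
     do { I0 \<leftarrow> uniform_subset {..<dim_row A} l0;
          Ja \<leftarrow> sel (rows_of A I0) la;
          Jb \<leftarrow> uniform_subset {..<dim_col A} lb;
          J0 \<leftarrow> uniform_subset {..<dim_col A} l0;
          Ia \<leftarrow> sel (transpose_mat (cols_of A J0)) la;
          Ib \<leftarrow> uniform_subset {..<dim_row A} lb;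
          return_pmf (Ia \<union> Ib, Ja \<union> Jb) }"

end

theory Submission
  imports Defs
begin

text \<open>
  The identity holds as soon as the rows of \<open>X\<close> in \<open>I\<close> and the rows of \<open>Y\<close> in \<open>J\<close> have full
  rank \<open>k\<close>. Call a row clean if the sparse block (\<open>X3\<close> for \<open>X\<close>, \<open>Y2\<close> for \<open>Y\<close>) vanishes on it.
  If the clean rows in \<open>I0\<close> have full rank on \<open>[X1 X2]\<close>, the selected columns \<open>Ja\<close> have full
  rank on \<open>[Y1 Y2]\<close>. The rows \<open>Ja\<close> of \<open>Y\<close> then have a kernel of dimension at most \<open>k3\<close>, which
  only has to be removed by the clean rows in \<open>Jb\<close>; the situation for \<open>X\<close> is symmetric.

  In place of a matrix Chernoff bound, the expected dimension of the kernel left by the sampled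
  clean rows is tracked. It decays geometrically, so with \<open>x = \<beta> l k3 / n\<close> and
  \<open>y = \<beta> l k2 / m\<close> the four phases fail with probability at most
  \<open>(k1 + k2) e^(x - \<alpha>)\<close>, \<open>k3 e^(y - \<alpha>)\<close>, \<open>(k1 + k3) e^(y - \<alpha>)\<close> and \<open>k2 e^(x - \<alpha>)\<close>.
  A plain union bound over the event that an unclean row is sampled would count both \<open>I0\<close> and
  \<open>Ib\<close> and exceed the claimed constants.
\<close>

text \<open>Unclean sampled rows are ignored, not forbidden. They only diminish the number of rows
  that shrink the kernel, by at most \<open>\<beta>\<close> per sparse column, and so a phase fails
  with a factor \<open>exp (x' - \<alpha>)\<close> instead of \<open>exp (- \<alpha>)\<close>
  (\<open>x'\<close> in the main proof is the \<open>x\<close> of the overview). The two row phases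
  together give (k1 + 2 k2) exp (x' - \<alpha>), and this growth factor must be traded for a single
  additive term \<beta> l k / n. Two sources of slack pay for it: x' carries k3 in place of k, so it
  is at most k3 / k times the additive term, and k1 + 2 k2 is at most 2 k (1 - k3 / k). The column
  phases are symmetric, and the coefficients add up to exactly 2 k. Column selection enters through
  rank: the singular value bound for the leading block passes positivity on, and positivity of a
  singular value is read off from Gram determinants via the multiplicity of the root 0 of a
  characteristic polynomial.\<close>

unbundle no inner_syntax

section \<open>Injective matrices and Gram determinants\<close>

lemma real_scalar_prod_self_ge_0: "v \<bullet> v \<ge> (0::real)"
  unfolding scalar_prod_def by (intro sum_nonneg) auto

lemma real_scalar_prod_self_eq_0:
  fixes v :: "real vec"
  assumes "v \<in> carrier_vec n" "v \<bullet> v = 0"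
  shows "v = 0\<^sub>v n"
proof -
  have "\<forall>i\<in>{0..<dim_vec v}. v $ i * v $ i = 0"
    using assms(2) unfolding scalar_prod_def
    by (subst (asm) sum_nonneg_eq_0_iff) auto
  then show ?thesis using assms(1) by (intro eq_vecI) auto
qed

lemma scalar_prod_transpose_mult:
  fixes M :: "real mat"
  assumes "M \<in> carrier_mat p q" "x \<in> carrier_vec q" "y \<in> carrier_vec p"
  shows "y \<bullet> (M *\<^sub>v x) = (transpose_mat M *\<^sub>v y) \<bullet> x"
  using transpose_vec_mult_scalar[OF assms] by simp

definition injective_mat :: "real mat \<Rightarrow> bool" where
  "injective_mat M \<longleftrightarrow>
     (\<forall>v\<in>carrier_vec (dim_col M). M *\<^sub>v v = 0\<^sub>v (dim_row M) \<longrightarrow> v = 0\<^sub>v (dim_col M))"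

lemma injective_matI:
  assumes "M \<in> carrier_mat p q"
    and "\<And>v. v \<in> carrier_vec q \<Longrightarrow> M *\<^sub>v v = 0\<^sub>v p \<Longrightarrow> v = 0\<^sub>v q"
  shows "injective_mat M"
  using assms unfolding injective_mat_def by auto

lemma injective_matD:
  assumes "injective_mat M" "M \<in> carrier_mat p q" "v \<in> carrier_vec q" "M *\<^sub>v v = 0\<^sub>v p"
  shows "v = 0\<^sub>v q"
  using assms unfolding injective_mat_def by auto

lemma mult_mat_zero_vec:
  fixes M :: "real mat"
  assumes "M \<in> carrier_mat p q"
  shows "M *\<^sub>v 0\<^sub>v q = 0\<^sub>v p"
  using assms by (intro eq_vecI) auto

text \<open>Over the reals |M v|^2 = v . (M^T M v), so the Gram matrix kills nothing that
  \<open>M\<close> does not. Full column rank thereby becomes the nonvanishing of a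
  determinant.\<close>

lemma gram_mult_vec_eq_0:
  fixes M :: "real mat"
  assumes M: "M \<in> carrier_mat p q" and v: "v \<in> carrier_vec q"
    and 0: "(transpose_mat M * M) *\<^sub>v v = 0\<^sub>v q"
  shows "M *\<^sub>v v = 0\<^sub>v p"
proof -
  have "(M *\<^sub>v v) \<bullet> (M *\<^sub>v v) = (transpose_mat M *\<^sub>v (M *\<^sub>v v)) \<bullet> v"
    using M v by (intro scalar_prod_transpose_mult) auto
  also have "transpose_mat M *\<^sub>v (M *\<^sub>v v) = 0\<^sub>v q"
    using 0 M v by (simp add: assoc_mult_mat_vec[of _ q p _ q])
  finally have "(M *\<^sub>v v) \<bullet> (M *\<^sub>v v) = 0" using v by simp
  then show ?thesis using M v by (intro real_scalar_prod_self_eq_0) auto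
qed

lemma injective_square_iff_det:
  assumes "M \<in> carrier_mat q q"
  shows "injective_mat M \<longleftrightarrow> det M \<noteq> 0"
  using det_0_iff_vec_prod_zero_field[OF assms] assms unfolding injective_mat_def by auto

lemma injective_iff_det_gram:
  assumes M: "M \<in> carrier_mat p q"
  shows "injective_mat M \<longleftrightarrow> det (transpose_mat M * M) \<noteq> 0"
proof -
  have G: "transpose_mat M * M \<in> carrier_mat q q" using M by auto
  have "injective_mat M \<longleftrightarrow> injective_mat (transpose_mat M * M)"
  proof
    assume i: "injective_mat M"
    show "injective_mat (transpose_mat M * M)"
      by (rule injective_matI[OF G]) (use gram_mult_vec_eq_0[OF M] injective_matD[OF i M] in blast)
  next
    assume i: "injective_mat (transpose_mat M * M)"
    show "injective_mat M"
    proof (rule injective_matI[OF M])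
      fix v assume v: "v \<in> carrier_vec q" "M *\<^sub>v v = 0\<^sub>v p"
      then have "(transpose_mat M * M) *\<^sub>v v = 0\<^sub>v q"
        using M by (simp add: assoc_mult_mat_vec[of _ q p _ q] mult_mat_zero_vec[of _ q p])
      then show "v = 0\<^sub>v q" using injective_matD[OF i G v(1)] by simp
    qed
  qed
  then show ?thesis using injective_square_iff_det[OF G] by simp
qed

lemma invertible_of_det:
  fixes G :: "real mat"
  assumes G: "G \<in> carrier_mat q q" and d: "det G \<noteq> 0"
  obtains H where "H \<in> carrier_mat q q" "G * H = 1\<^sub>m q" "H * G = 1\<^sub>m q"
  using det_non_zero_imp_unit[OF G d, of "()"]
  unfolding Units_def ring_mat_def by auto

text \<open>Padding with zero rows gives a square matrix whose transpose kills the unit vector at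
  the first padded position. Its determinant vanishes, which yields a kernel vector.\<close>

lemma wide_mat_kernel:
  fixes M :: "real mat"
  assumes M: "M \<in> carrier_mat p q" and "p < q"
  shows "\<exists>v. v \<in> carrier_vec q \<and> v \<noteq> 0\<^sub>v q \<and> M *\<^sub>v v = 0\<^sub>v p"
proof -
  define N where "N = mat q q (\<lambda>(i, j). if i < p then M $$ (i, j) else 0)"
  have N: "N \<in> carrier_mat q q" by (simp add: N_def)
  have "transpose_mat N *\<^sub>v unit_vec q p = 0\<^sub>v q"
    using \<open>p < q\<close> by (intro eq_vecI) (auto simp: N_def)
  then have "det (transpose_mat N) = 0"
    using det_0_iff_vec_prod_zero_field[of "transpose_mat N" q] N \<open>p < q\<close>
    by (auto intro!: exI[of _ "unit_vec q p"])
  then have "det N = 0" using det_transpose[OF N] by simp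
  then obtain v where v: "v \<in> carrier_vec q" "v \<noteq> 0\<^sub>v q" "N *\<^sub>v v = 0\<^sub>v q"
    using det_0_iff_vec_prod_zero_field[OF N] by auto
  have "M *\<^sub>v v = 0\<^sub>v p"
  proof (rule eq_vecI)
    fix i assume "i < dim_vec (0\<^sub>v p :: real vec)"
    then have i: "i < p" by simp
    have "row M i = row N i" using i M \<open>p < q\<close> by (intro eq_vecI) (auto simp: N_def)
    then have "(M *\<^sub>v v) $ i = (N *\<^sub>v v) $ i" using i M N \<open>p < q\<close> by simp
    then show "(M *\<^sub>v v) $ i = 0\<^sub>v p $ i" using v(3) i \<open>p < q\<close> by simp
  qed (use M in auto)
  then show ?thesis using v by blast
qed

lemma injective_mat_dim_le:
  assumes "injective_mat M" "M \<in> carrier_mat p q"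
  shows "q \<le> p"
  using wide_mat_kernel[OF assms(2)] injective_matD[OF assms] by (meson not_le)

lemma left_inverse_imp_injective:
  fixes M :: "real mat"
  assumes "M \<in> carrier_mat p q" "L \<in> carrier_mat q p" "L * M = 1\<^sub>m q"
  shows "injective_mat M"
proof (rule injective_matI[OF assms(1)])
  fix v assume v: "v \<in> carrier_vec q" "M *\<^sub>v v = 0\<^sub>v p"
  have "(L * M) *\<^sub>v v = L *\<^sub>v (M *\<^sub>v v)" using assms v by (intro assoc_mult_mat_vec)
  then show "v = 0\<^sub>v q" using assms v by (simp add: mult_mat_zero_vec[of _ q p])
qed

lemma injective_mat_mult:
  assumes "injective_mat M" "injective_mat N" "M \<in> carrier_mat p q" "N \<in> carrier_mat q s"
  shows "injective_mat (M * N)"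
proof (rule injective_matI)
  show "M * N \<in> carrier_mat p s" using assms by auto
  fix v assume v: "v \<in> carrier_vec s" "(M * N) *\<^sub>v v = 0\<^sub>v p"
  then have "M *\<^sub>v (N *\<^sub>v v) = 0\<^sub>v p" using assms by (simp add: assoc_mult_mat_vec[of _ p q _ s])
  then have "N *\<^sub>v v = 0\<^sub>v q" using injective_matD[OF assms(1,3)] assms v by auto
  then show "v = 0\<^sub>v s" using injective_matD[OF assms(2,4)] v by auto
qed

lemma injective_mat_right:
  assumes "injective_mat (M * N)" "M \<in> carrier_mat p q" "N \<in> carrier_mat q s"
  shows "injective_mat N"
proof (rule injective_matI[OF assms(3)])
  fix v assume v: "v \<in> carrier_vec s" "N *\<^sub>v v = 0\<^sub>v q"
  then have "(M * N) *\<^sub>v v = 0\<^sub>v p" using assms by (simp add: assoc_mult_mat_vec[of _ p q _ s] mult_mat_zero_vec[of _ p q])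
  then show "v = 0\<^sub>v s" using injective_matD[OF assms(1), of p s] assms v by auto
qed

lemma mrank_eq_dim_col_imp_injective:
  assumes M: "M \<in> carrier_mat p q" and r: "mrank M = q"
  shows "injective_mat M"
proof (rule injective_matI[OF M])
  interpret vec_space "TYPE(real)" p .
  fix v assume v: "v \<in> carrier_vec q" "M *\<^sub>v v = 0\<^sub>v p"
  have rk: "rank M = q" using r M by auto
  obtain S where S: "maximal S (\<lambda>T. T \<subseteq> set (cols M) \<and> lin_indpt T)"
    using maximal_exists_superset[of "set (cols M)" "\<lambda>T. T \<subseteq> set (cols M) \<and> lin_indpt T" "{}"]
      finite_lin_indpt2[of "{}"] by auto
  then have "q = card S" using rank_card_indpt[OF M S] rk by simp
  also have "\<dots> \<le> card (set (cols M))" using S by (intro card_mono) (auto simp: maximal_def)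
  \<comment> \<open>Independence concerns the set of columns, to which a repeated column is
    invisible; full rank excludes repetitions.\<close>
  finally have d: "distinct (cols M)"
    using M card_length[of "cols M"] by (intro card_distinct) (auto simp: le_antisym)
  have li: "lin_indpt (set (cols M))" using full_rank_lin_indpt[OF M rk d] .
  show "v = 0\<^sub>v q"
    using lin_depI[OF M v(1) _ v(2) d] li by blast
qed

section \<open>Characteristic polynomials of the products P Q and Q P\<close>

lemma const_poly_sum: "[:(\<Sum>x\<in>A. f x) :: 'a::comm_ring_1:] = (\<Sum>x\<in>A. [:f x:])"
proof (induction A rule: infinite_finite_induct)
  case (insert x F)
  have "[:f x + sum f F:] = [:f x:] + [:sum f F:]" by simp
  then show ?case using insert by simp
qed auto

text \<open>Sylvester's identity. It carries the multiplicity of the eigenvalue 0 over from a large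
  Gram matrix to a small square matrix.\<close>

lemma char_poly_mult_swap:
  fixes P Q :: "'a::idom mat"
  assumes P: "P \<in> carrier_mat q r" and Q: "Q \<in> carrier_mat r q"
  shows "[:0, 1:] ^ r * char_poly (P * Q) = [:0, 1:] ^ q * char_poly (Q * P)"
proof -
  define c where "c = map_mat (\<lambda>a::'a. [:a:])"
  define X :: "'a poly" where "X = [:0, 1:]"
  have c: "c B \<in> carrier_mat s t" if "B \<in> carrier_mat s t" for B s t
    using that by (auto simp: c_def)
  have cm: "char_poly_matrix (B * D) = X \<cdot>\<^sub>m 1\<^sub>m s + (- c B) * c D"
    if B: "B \<in> carrier_mat s t" and D: "D \<in> carrier_mat t s" for B D s t
  proof (rule eq_matI)
    fix i j assume "i < dim_row (X \<cdot>\<^sub>m 1\<^sub>m s + (- c B) * c D)" "j < dim_col (X \<cdot>\<^sub>m 1\<^sub>m s + (- c B) * c D)"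
    then have ij: "i < s" "j < s" using B D by (auto simp: c_def)
    have "[:- (\<Sum>x = 0..<t. B $$ (i, x) * D $$ (x, j)):]
        = - (\<Sum>x = 0..<t. [:B $$ (i, x):] * [:D $$ (x, j):])"
    proof -
      have "(\<Sum>x = 0..<t. [:B $$ (i, x):] * [:D $$ (x, j):])
          = [:\<Sum>x = 0..<t. B $$ (i, x) * D $$ (x, j):]"
        unfolding const_poly_sum by (intro sum.cong) (auto simp: mult.commute)
      then show ?thesis by simp
    qed
    then show "char_poly_matrix (B * D) $$ (i, j) = (X \<cdot>\<^sub>m 1\<^sub>m s + (- c B) * c D) $$ (i, j)"
      using ij B D
      by (simp add: char_poly_matrix_def c_def X_def scalar_prod_def sum_negf)
  qed (use B D in \<open>auto simp: c_def char_poly_matrix_def\<close>)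
  \<comment> \<open>Two block eliminations on \<open>N\<close>: \<open>L\<close> clears the upper
    right block and leaves the characteristic matrix of \<open>P * Q\<close>, \<open>R\<close>
    clears the lower left block and leaves that of \<open>Q * P\<close>. The powers come from det L
    = 1 and det R = X^r.\<close>
  define N where "N = four_block_mat (X \<cdot>\<^sub>m 1\<^sub>m q) (c P) (c Q) (1\<^sub>m r)"
  have N: "N \<in> carrier_mat (q + r) (q + r)" unfolding N_def using P Q c by auto
  define L where "L = four_block_mat (1\<^sub>m q) (- c P) (0\<^sub>m r q) (1\<^sub>m r)"
  have L: "L \<in> carrier_mat (q + r) (q + r)" unfolding L_def using P Q c by auto
  define R where "R = four_block_mat (1\<^sub>m q) (0\<^sub>m q r) (- c Q) (X \<cdot>\<^sub>m 1\<^sub>m r)"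
  have R: "R \<in> carrier_mat (q + r) (q + r)" unfolding R_def using P Q c by auto
  have dL: "det L = 1" unfolding L_def
    by (subst det_four_block_mat_lower_left_zero[of _ q _ r]) (use P c in auto)
  have dR: "det R = X ^ r" unfolding R_def
    by (subst det_four_block_mat_upper_right_zero[of _ q _ r]) (use Q c in \<open>auto\<close>)
  have "L * N = four_block_mat (char_poly_matrix (P * Q)) (0\<^sub>m q r) (c Q) (1\<^sub>m r)"
    unfolding L_def N_def
    apply (subst mult_four_block_mat[of _ q q _ r _ r _ _ q _ r])
    using P Q c[OF P] c[OF Q]
    by (auto simp: cm[OF P Q] uminus_l_inv_mat comm_add_mat[of _ q r])
  then have "det (L * N) = det (char_poly_matrix (P * Q)) * det (1\<^sub>m r)"
    using P Q c[OF Q] by (metis det_four_block_mat_upper_right_zero char_poly_matrix_closed mult_carrier_mat one_carrier_mat)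
  then have dN: "det N = char_poly (P * Q)"
    using det_mult[OF L N] dL by (simp add: char_poly_def)
  have "R * N = four_block_mat (X \<cdot>\<^sub>m 1\<^sub>m q) (c P) (0\<^sub>m r q) (char_poly_matrix (Q * P))"
    unfolding R_def N_def
    apply (subst mult_four_block_mat[of _ q q _ r _ r _ _ q _ r])
    using P Q c[OF P] c[OF Q]
    by (auto simp: cm[OF Q P] uminus_l_inv_mat mult_smult_distrib[of _ r q _ q] mult_smult_assoc_mat[of _ r r _ q] comm_add_mat[of _ r r])
  then have "det (R * N) = det (X \<cdot>\<^sub>m 1\<^sub>m q) * det (char_poly_matrix (Q * P))"
    using P Q c[OF P] by (metis det_four_block_mat_lower_left_zero char_poly_matrix_closed mult_carrier_mat one_carrier_mat smult_carrier_mat)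
  then show ?thesis
    using det_mult[OF R N] dR dN by (simp add: char_poly_def X_def)
qed

section \<open>Positive singular values\<close>

text \<open>Nonnegativity and ascending order put the zeros exactly at the first positions.\<close>

lemma count_zeros_sorted:
  fixes ys :: "real list"
  assumes "sorted ys" "\<forall>y\<in>set ys. y \<ge> 0" "j < length ys"
  shows "ys ! j > 0 \<longleftrightarrow> count (mset ys) 0 \<le> j"
proof -
  have c: "count (mset ys) 0 = card {i. i < length ys \<and> ys ! i = 0}"
  proof -
    have "count (mset ys) 0 = length (filter (\<lambda>y. y = 0) ys)" by (induction ys) auto
    then show ?thesis by (simp add: length_filter_conv_card)
  qed
  show ?thesis
  proof (cases "ys ! j > 0")
    case True
    have "{i. i < length ys \<and> ys ! i = 0} \<subseteq> {..<j}"
    proof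
      fix i assume "i \<in> {i. i < length ys \<and> ys ! i = 0}"
      then show "i \<in> {..<j}"
        using sorted_nth_mono[OF assms(1), of j i] True by (cases "i < j") auto
    qed
    then have "card {i. i < length ys \<and> ys ! i = 0} \<le> card {..<j}" by (intro card_mono) auto
    then show ?thesis using True c by simp
  next
    case False
    then have 0: "ys ! j = 0" using assms by (auto simp: not_less intro: antisym)
    have "{..j} \<subseteq> {i. i < length ys \<and> ys ! i = 0}"
    proof
      fix i assume "i \<in> {..j}"
      then show "i \<in> {i. i < length ys \<and> ys ! i = 0}"
        using sorted_nth_mono[OF assms(1), of i j] 0 assms by (auto intro!: antisym)
    qed
    then have "card {..j} \<le> card {i. i < length ys \<and> ys ! i = 0}" by (intro card_mono) auto
    then show ?thesis using False c by simp
  qed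
qed

text \<open>\<open>a\<close> is the Rayleigh quotient |M v|^2 / |v|^2, since a real \<open>M\<close>
  commutes with conjugation. Complex eigenvectors are treated because a splitting of the
  characteristic polynomial is at hand only over the complex numbers.\<close>

lemma eigenvalue_gram_nonneg:
  fixes M :: "real mat" and a :: complex
  assumes M: "M \<in> carrier_mat p q"
    and ev: "eigenvalue (map_mat complex_of_real (transpose_mat M * M)) a"
  shows "\<exists>b\<ge>0. a = complex_of_real b"
proof -
  let ?c = "map_mat complex_of_real"
  let ?M = "?c M"
  have cM: "?M \<in> carrier_mat p q" using M by simp
  have G: "?c (transpose_mat M * M) = transpose_mat ?M * ?M"
    using M by (subst of_real_hom.mat_hom_mult[of _ q p]) (auto simp: map_mat_transpose)
  obtain v where v: "v \<in> carrier_vec q" "v \<noteq> 0\<^sub>v q" "(transpose_mat ?M * ?M) *\<^sub>v v = a \<cdot>\<^sub>v v"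
    using ev M unfolding eigenvalue_def eigenvector_def G by auto
  define n2 :: "complex vec \<Rightarrow> real" where "n2 w = (\<Sum>i<dim_vec w. (cmod (w $ i))\<^sup>2)" for w
  have cs: "conjugate w \<bullet> w = complex_of_real (n2 w)" for w :: "complex vec"
    unfolding scalar_prod_def n2_def
    by (simp add: lessThan_atLeast0 complex_norm_square mult.commute del: of_real_power)
  have cj: "conjugate (?M *\<^sub>v v) = ?M *\<^sub>v conjugate v"
    using cM v(1) by (intro eq_vecI) (auto simp: scalar_prod_def)
  have "conjugate v \<bullet> ((transpose_mat ?M * ?M) *\<^sub>v v) = conjugate v \<bullet> (transpose_mat ?M *\<^sub>v (?M *\<^sub>v v))"
    using cM v(1) by (simp add: assoc_mult_mat_vec[of _ q p _ q])
  also have "\<dots> = (transpose_mat ?M *\<^sub>v (?M *\<^sub>v v)) \<bullet> conjugate v"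
    using cM v(1) by (intro comm_scalar_prod[of _ q]) auto
  also have "\<dots> = (?M *\<^sub>v v) \<bullet> (?M *\<^sub>v conjugate v)"
    using cM v(1) by (intro transpose_vec_mult_scalar) auto
  also have "\<dots> = (?M *\<^sub>v conjugate v) \<bullet> (?M *\<^sub>v v)"
    using cM v(1) by (intro comm_scalar_prod[of _ p]) auto
  also have "\<dots> = complex_of_real (n2 (?M *\<^sub>v v))" using cs[of "?M *\<^sub>v v"] cj by simp
  finally have "a * complex_of_real (n2 v) = complex_of_real (n2 (?M *\<^sub>v v))"
    using v cs[of v] by (simp add: scalar_prod_smult_right)
  moreover have "n2 v > 0"
  proof -
    obtain i where i: "i < q" "v $ i \<noteq> 0" using v(1,2) by (auto simp: vec_eq_iff)
    have "(cmod (v $ i))\<^sup>2 \<le> n2 v" unfolding n2_def using i v(1) by (intro member_le_sum) auto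
    then show ?thesis using i by (smt (verit) zero_less_norm_iff zero_less_power)
  qed
  moreover have "n2 (?M *\<^sub>v v) \<ge> 0" unfolding n2_def by (intro sum_nonneg) auto
  ultimately have "a = complex_of_real (n2 (?M *\<^sub>v v) / n2 v)" "n2 (?M *\<^sub>v v) / n2 v \<ge> 0"
    by (auto simp: field_simps)
  then show ?thesis by blast
qed

text \<open>Stands in for the spectral theorem: all complex roots are real and nonnegative, and the
  factorization descends because real polynomials embed injectively.\<close>

lemma char_poly_gram_splits:
  fixes M :: "real mat"
  assumes M: "M \<in> carrier_mat p q"
  obtains bs where "length bs = q" "\<forall>b\<in>set bs. b \<ge> 0"
    "char_poly (transpose_mat M * M) = (\<Prod>b\<leftarrow>bs. [:- b, 1:])"
proof -
  let ?G = "transpose_mat M * M"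
  let ?c = "map_mat complex_of_real"
  have G: "?G \<in> carrier_mat q q" using M by auto
  then have cG: "?c ?G \<in> carrier_mat q q" by auto
  obtain as where as: "char_poly (?c ?G) = (\<Prod>a\<leftarrow>as. [:- a, 1:])" "length as = q"
    using char_poly_factorized[OF cG] by auto
  have "\<exists>b\<ge>0. a = complex_of_real b" if a: "a \<in> set as" for a
  proof -
    have "poly (char_poly (?c ?G)) a = 0" using a unfolding as(1) poly_prod_list prod_list_zero_iff by auto
    then show ?thesis using eigenvalue_gram_nonneg[OF M] eigenvalue_root_char_poly[OF cG] by blast
  qed
  then obtain g where g: "\<And>a. a \<in> set as \<Longrightarrow> g a \<ge> 0 \<and> a = complex_of_real (g a)" by metis
  define bs where "bs = map g as"
  have as_bs: "as = map complex_of_real bs"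
    unfolding bs_def using g by (simp add: map_idI comp_def)
  interpret h: map_poly_inj_idom_hom complex_of_real ..
  have "map_poly complex_of_real (char_poly ?G) = char_poly (?c ?G)"
    by (rule of_real_hom.char_poly_hom[OF G, symmetric])
  also have "\<dots> = (\<Prod>b\<leftarrow>bs. map_poly complex_of_real [:- b, 1:])"
    unfolding as(1) as_bs by (simp add: comp_def)
  also have "\<dots> = map_poly complex_of_real (\<Prod>b\<leftarrow>bs. [:- b, 1:])"
    by (induction bs) (simp_all add: h.hom_mult del: mult_pCons_left)
  finally have "char_poly ?G = (\<Prod>b\<leftarrow>bs. [:- b, 1:])"
    by simp
  then show ?thesis using that[of bs] as(2) g by (auto simp: bs_def)
qed

text \<open>The list has length \<open>q\<close>, zeros included, and the number of zeros is the
  multiplicity of the root 0.\<close>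

lemma singular_value_pos_iff:
  assumes M: "M \<in> carrier_mat p q" and i: "1 \<le> i" "i \<le> q"
  shows "singular_value M i > 0 \<longleftrightarrow> i + Polynomial.order 0 (char_poly (transpose_mat M * M)) \<le> q"
proof -
  obtain bs where bs: "length bs = q" "\<forall>b\<in>set bs. b \<ge> 0"
    "char_poly (transpose_mat M * M) = (\<Prod>b\<leftarrow>bs. [:- b, 1:])"
    using char_poly_gram_splits[OF M] .
  have nz: "(\<Prod>b\<leftarrow>bs. [:- b, 1:]) \<noteq> 0" by (auto simp: prod_list_zero_iff)
  have pr: "proots (\<Prod>b\<leftarrow>bs. [:- b, 1:]) = mset bs"
  proof (induction bs)
    case (Cons a bs)
    have "[:- a, 1:] * (\<Prod>b\<leftarrow>bs. [:- b, 1:]) \<noteq> 0"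
      by (auto simp: prod_list_zero_iff simp del: mult_pCons_left)
    then show ?case using proots_mult[of "[:- a, 1:]" "\<Prod>b\<leftarrow>bs. [:- b, 1:]"] Cons.IH
      by (simp add: prod_list_zero_iff del: mult_pCons_left mult_eq_0_iff)
  qed simp
  define ys where "ys = sort (map sqrt bs)"
  have sv: "singular_values M = rev ys"
    unfolding singular_values_def bs(3) pr ys_def
    by (simp flip: mset_map)
  have ys: "length ys = q" "sorted ys" "\<forall>y\<in>set ys. y \<ge> 0" using bs by (auto simp: ys_def)
  have "mset ys = image_mset sqrt (mset bs)" by (simp add: ys_def)
  moreover have "count (image_mset sqrt (mset bs)) 0 = count (mset bs) 0" by (induction bs) auto
  ultimately have "count (mset ys) 0 = count (mset bs) 0" by simp
  also have "\<dots> = Polynomial.order 0 (char_poly (transpose_mat M * M))"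
    using count_proots[OF nz, of 0] by (simp only: bs(3) pr)
  finally have "count (mset ys) 0 = \<dots>" .
  \<comment> \<open>\<open>i\<close> counts from 1 in the descending list, which is position
    \<open>q - i\<close> of the ascending \<open>ys\<close>.\<close>
  moreover have "singular_value M i = ys ! (q - i)"
    unfolding singular_value_def sv using i ys by (simp add: rev_nth)
  ultimately show ?thesis using count_zeros_sorted[OF ys(2,3), of "q - i"] ys i by auto
qed

text \<open>The Gram matrix of \<open>E * C\<close> is C^T (E^T E C). Swapping the two factors
  leaves the \<open>r\<close> by \<open>r\<close> matrix \<open>H\<close> with \<open>q - r\<close>
  fewer zero eigenvalues, so the question becomes whether \<open>H\<close> is invertible.\<close>

lemma singular_value_pos_iff_det:
  fixes E C :: "real mat"
  assumes E: "E \<in> carrier_mat p r" and C: "C \<in> carrier_mat r q" and r: "1 \<le> r" "r \<le> q"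
  shows "singular_value (E * C) r > 0 \<longleftrightarrow>
    det (transpose_mat E * E) \<noteq> 0 \<and> det (C * transpose_mat C) \<noteq> 0"
proof -
  let ?M = "E * C" and ?EE = "transpose_mat E * E" and ?CC = "C * transpose_mat C"
  have EE: "?EE \<in> carrier_mat r r" and CC: "?CC \<in> carrier_mat r r" using E C by auto
  define H where "H = ?EE * ?CC"
  have H: "H \<in> carrier_mat r r" unfolding H_def using EE CC by auto
  have M: "?M \<in> carrier_mat p q" using E C by auto
  have "transpose_mat ?M * ?M = transpose_mat C * transpose_mat E * (E * C)"
    using E C by (simp add: transpose_mult[of _ p r _ q])
  also have "\<dots> = transpose_mat C * (?EE * C)"
    using E C by (simp add: assoc_mult_mat[of _ q r _ p _ q] assoc_mult_mat[of _ r p _ r _ q])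
  finally have MM: "transpose_mat ?M * ?M = transpose_mat C * (?EE * C)" .
  have QP: "(?EE * C) * transpose_mat C = H"
    unfolding H_def using C EE by (intro assoc_mult_mat) auto
  have id: "[:0, 1:] ^ r * char_poly (transpose_mat ?M * ?M) = [:0, 1:] ^ q * char_poly H"
    unfolding MM QP[symmetric] using E C by (intro char_poly_mult_swap) auto
  have nz: "char_poly N \<noteq> 0" if "N \<in> carrier_mat s s" for N :: "real mat" and s
    using degree_monic_char_poly[OF that] by auto
  have X: "Polynomial.order 0 ([:0, 1:] ^ s :: real poly) = s" for s
    using order_power_n_n[of "0::real" s] by simp
  have n1: "char_poly (transpose_mat ?M * ?M) \<noteq> 0" using M by (intro nz[of _ q]) auto
  have n2: "char_poly H \<noteq> 0" using H by (rule nz)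
  have "r + Polynomial.order 0 (char_poly (transpose_mat ?M * ?M)) = q + Polynomial.order 0 (char_poly H)"
    using arg_cong[OF id, of "Polynomial.order 0"] n1 n2 by (simp add: order_mult X)
  then have "singular_value ?M r > 0 \<longleftrightarrow> Polynomial.order 0 (char_poly H) = 0"
    using singular_value_pos_iff[OF M r] by auto
  also have "\<dots> \<longleftrightarrow> poly (char_poly H) 0 \<noteq> 0" using n2 by (simp add: order_root)
  also have "\<dots> \<longleftrightarrow> det H \<noteq> 0"
  proof -
    have "0 \<cdot>\<^sub>v v = 0\<^sub>v r" if "v \<in> carrier_vec r" for v :: "real vec"
      using that by (intro eq_vecI) auto
    then show ?thesis using eigenvalue_root_char_poly[OF H, of 0] det_0_iff_vec_prod_zero_field[OF H] H
      by (auto simp: eigenvalue_def eigenvector_def)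
  qed
  also have "\<dots> \<longleftrightarrow> det ?EE \<noteq> 0 \<and> det ?CC \<noteq> 0" unfolding H_def using det_mult[OF EE CC] by simp
  finally show ?thesis .
qed

section \<open>Orthonormal families in subspaces\<close>

definition subspace_of :: "nat \<Rightarrow> real vec set \<Rightarrow> bool" where
  "subspace_of r V \<longleftrightarrow> V \<subseteq> carrier_vec r \<and> 0\<^sub>v r \<in> V \<and>
     (\<forall>x\<in>V. \<forall>y\<in>V. x + y \<in> V) \<and> (\<forall>a. \<forall>x\<in>V. a \<cdot>\<^sub>v x \<in> V)"

definition ortho_family :: "nat \<Rightarrow> real vec set \<Rightarrow> nat \<Rightarrow> real mat \<Rightarrow> bool" where
  "ortho_family r V d W \<longleftrightarrow> W \<in> carrier_mat r d \<and> transpose_mat W * W = 1\<^sub>m d \<and>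
     (\<forall>j<d. col W j \<in> V)"

lemma subspace_mult_vec:
  assumes V: "subspace_of r V" and W: "W \<in> carrier_mat r d" "\<forall>j<d. col W j \<in> V"
    and c: "c \<in> carrier_vec d"
  shows "W *\<^sub>v c \<in> V"
proof -
  have "vec r (\<lambda>i. \<Sum>j<e. W $$ (i, j) * c $ j) \<in> V" if "e \<le> d" for e
    using that
  proof (induction e)
    case 0
    have "vec r (\<lambda>i. \<Sum>j<0. W $$ (i, j) * c $ j) = 0\<^sub>v r" by (intro eq_vecI) auto
    then show ?case using V by (simp add: subspace_of_def)
  next
    case (Suc e)
    have "vec r (\<lambda>i. \<Sum>j<Suc e. W $$ (i, j) * c $ j) =
        vec r (\<lambda>i. \<Sum>j<e. W $$ (i, j) * c $ j) + c $ e \<cdot>\<^sub>v col W e"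
      using Suc.prems W by (intro eq_vecI) auto
    moreover have "c $ e \<cdot>\<^sub>v col W e \<in> V"
      using V W Suc.prems by (auto simp: subspace_of_def)
    ultimately show ?case using V Suc by (auto simp: subspace_of_def)
  qed
  from this[of d] have "vec r (\<lambda>i. \<Sum>j<d. W $$ (i, j) * c $ j) \<in> V" by simp
  moreover have "W *\<^sub>v c = vec r (\<lambda>i. \<Sum>j<d. W $$ (i, j) * c $ j)"
    using W c by (intro eq_vecI) (auto simp: scalar_prod_def lessThan_atLeast0)
  ultimately show ?thesis by simp
qed

lemma ortho_family_injective:
  assumes "ortho_family r V d W"
  shows "injective_mat W"
  using assms unfolding ortho_family_def
  by (intro left_inverse_imp_injective[of W r d "transpose_mat W"]) auto

lemma ortho_family_dim_le:
  assumes "ortho_family r V d W"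
  shows "d \<le> r"
  using injective_mat_dim_le[OF ortho_family_injective[OF assms]] assms
  by (auto simp: ortho_family_def)

lemma ortho_family_empty: "ortho_family r V 0 (0\<^sub>m r 0)"
  unfolding ortho_family_def by (auto intro!: eq_matI)

text \<open>The dimension, when \<open>V\<close> is a subspace. Orthonormal families are the
  convenient witnesses because the sampling argument sums squared entries of \<open>U\<close> times
  such a family.\<close>

definition ortho_dim :: "nat \<Rightarrow> real vec set \<Rightarrow> nat" where
  "ortho_dim r V = Max {d. \<exists>W. ortho_family r V d W}"

lemma ortho_dims_finite: "finite {d. \<exists>W. ortho_family r V d W}"
  by (rule finite_subset[of _ "{..r}"]) (use ortho_family_dim_le in auto)

lemma ortho_dim_ge: "ortho_family r V d W \<Longrightarrow> d \<le> ortho_dim r V"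
  unfolding ortho_dim_def using ortho_dims_finite by (intro Max_ge) auto

lemma ortho_dim_attained: obtains W where "ortho_family r V (ortho_dim r V) W"
proof -
  have "ortho_dim r V \<in> {d. \<exists>W. ortho_family r V d W}"
    unfolding ortho_dim_def using ortho_dims_finite ortho_family_empty[of r V]
    by (intro Max_in) (simp, blast)
  then show ?thesis using that by auto
qed

lemma ortho_dim_mono: "V \<subseteq> V' \<Longrightarrow> ortho_dim r V \<le> ortho_dim r V'"
proof -
  assume "V \<subseteq> V'"
  obtain W where "ortho_family r V (ortho_dim r V) W" by (rule ortho_dim_attained)
  then have "ortho_family r V' (ortho_dim r V) W" using \<open>V \<subseteq> V'\<close> by (auto simp: ortho_family_def)
  then show ?thesis by (rule ortho_dim_ge)
qed

lemma ortho_residual: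
  fixes W :: "real mat"
  assumes W: "W \<in> carrier_mat r d" "transpose_mat W * W = 1\<^sub>m d" and v: "v \<in> carrier_vec r"
  shows "transpose_mat W *\<^sub>v (v - W *\<^sub>v (transpose_mat W *\<^sub>v v)) = 0\<^sub>v d"
proof -
  let ?c = "transpose_mat W *\<^sub>v v"
  have "transpose_mat W *\<^sub>v (W *\<^sub>v ?c) = (transpose_mat W * W) *\<^sub>v ?c"
    using W(1) v by (intro assoc_mult_mat_vec[symmetric, of _ d r _ d]) auto
  also have "\<dots> = ?c" unfolding W(2) using W(1) v by (intro one_mult_mat_vec) auto
  finally show ?thesis using W v by (simp add: mult_minus_distrib_mat_vec[of _ d r])
qed

text \<open>The gap is the squared length of the residual v - W W^T v.\<close>

lemma bessel:
  fixes W :: "real mat"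
  assumes W: "W \<in> carrier_mat r d" "transpose_mat W * W = 1\<^sub>m d" and v: "v \<in> carrier_vec r"
  shows "(transpose_mat W *\<^sub>v v) \<bullet> (transpose_mat W *\<^sub>v v) \<le> v \<bullet> v"
proof -
  let ?c = "transpose_mat W *\<^sub>v v"
  let ?s = "v - W *\<^sub>v ?c"
  have c: "?c \<in> carrier_vec d" and s: "?s \<in> carrier_vec r" and Wc: "W *\<^sub>v ?c \<in> carrier_vec r"
    using W v by auto
  have "?s \<bullet> (W *\<^sub>v ?c) = (transpose_mat W *\<^sub>v ?s) \<bullet> ?c"
    using W c s by (intro scalar_prod_transpose_mult) auto
  then have 0: "?s \<bullet> (W *\<^sub>v ?c) = 0" using ortho_residual[OF W v] c by simp
  have "?s \<bullet> ?s = ?s \<bullet> v - ?s \<bullet> (W *\<^sub>v ?c)"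
    using s v Wc by (intro scalar_prod_minus_distrib) auto
  also have "\<dots> = v \<bullet> v - (W *\<^sub>v ?c) \<bullet> v"
    using 0 v Wc by (simp add: minus_scalar_prod_distrib[of _ r])
  also have "(W *\<^sub>v ?c) \<bullet> v = v \<bullet> (W *\<^sub>v ?c)" using v Wc by (intro comm_scalar_prod) auto
  also have "\<dots> = ?c \<bullet> ?c" using W v c by (intro scalar_prod_transpose_mult) auto
  finally show ?thesis using real_scalar_prod_self_ge_0[of ?s] by simp
qed

text \<open>A nonzero residual could be normalized and appended to the family.\<close>

lemma ortho_family_maximal:
  assumes V: "subspace_of r V" and W: "ortho_family r V (ortho_dim r V) W" and v: "v \<in> V"
  shows "W *\<^sub>v (transpose_mat W *\<^sub>v v) = v"
proof (rule ccontr)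
  define d where "d = ortho_dim r V"
  let ?c = "transpose_mat W *\<^sub>v v"
  define s where "s = v - W *\<^sub>v ?c"
  have Wd: "W \<in> carrier_mat r d" "transpose_mat W * W = 1\<^sub>m d" "\<forall>j<d. col W j \<in> V"
    using W by (auto simp: ortho_family_def d_def)
  have vc: "v \<in> carrier_vec r" using V v by (auto simp: subspace_of_def)
  have WcV: "W *\<^sub>v ?c \<in> V" using Wd vc by (intro subspace_mult_vec[OF V]) auto
  have Wc: "W *\<^sub>v ?c \<in> carrier_vec r" and s: "s \<in> carrier_vec r" using Wd vc by (auto simp: s_def)
  assume ne: "W *\<^sub>v ?c \<noteq> v"
  have "s \<noteq> 0\<^sub>v r"
  proof
    assume s0: "s = 0\<^sub>v r"
    have "(W *\<^sub>v ?c) $ i = v $ i" if "i < r" for i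
      using arg_cong[OF s0, of "\<lambda>x. x $ i"] that Wd(1) vc by (simp add: s_def)
    then have "W *\<^sub>v ?c = v" using Wc Wd(1) vc by (intro eq_vecI) auto
    then show False using ne by simp
  qed
  then have "s \<bullet> s \<noteq> 0" using real_scalar_prod_self_eq_0[OF s] by blast
  then have pos: "s \<bullet> s > 0" using real_scalar_prod_self_ge_0[of s] by simp
  define u where "u = (1 / sqrt (s \<bullet> s)) \<cdot>\<^sub>v s"
  have u: "u \<in> carrier_vec r" using s by (simp add: u_def)
  have uu: "u \<bullet> u = 1" using s pos by (simp add: u_def)
  have "s = v + (- 1) \<cdot>\<^sub>v (W *\<^sub>v ?c)" unfolding s_def using Wc vc by (intro eq_vecI) auto
  then have "s \<in> V" using V v WcV by (auto simp: subspace_of_def)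
  then have uV: "u \<in> V" using V by (auto simp: subspace_of_def u_def)
  have orth: "col W j \<bullet> u = 0" if "j < d" for j
  proof -
    have "(transpose_mat W *\<^sub>v s) $ j = 0" using ortho_residual[OF Wd(1,2) vc] that by (simp add: s_def)
    then have "col W j \<bullet> s = 0" using that Wd by simp
    then show ?thesis using that Wd s by (simp add: u_def)
  qed
  define W' where "W' = mat r (Suc d) (\<lambda>(i, j). if j < d then W $$ (i, j) else u $ i)"
  have W': "W' \<in> carrier_mat r (Suc d)" by (simp add: W'_def)
  have colW': "col W' j = (if j < d then col W j else u)" if "j < Suc d" for j
    using that Wd u by (intro eq_vecI) (auto simp: W'_def)
  have WW: "col W i \<bullet> col W j = (if i = j then 1 else 0)" if "i < d" "j < d" for i j
  proof -
    have "(transpose_mat W * W) $$ (i, j) = col W i \<bullet> col W j" using that Wd(1) by simp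
    then show ?thesis using that Wd(2) by simp
  qed
  have "transpose_mat W' * W' = 1\<^sub>m (Suc d)"
  proof (rule eq_matI)
    fix i j assume "i < dim_row (1\<^sub>m (Suc d) :: real mat)" "j < dim_col (1\<^sub>m (Suc d) :: real mat)"
    then have ij: "i < Suc d" "j < Suc d" by auto
    have "u \<bullet> col W j = 0" if "j < d" for j
      using orth[OF that] u Wd that by (subst comm_scalar_prod[of _ r]) auto
    then show "(transpose_mat W' * W') $$ (i, j) = 1\<^sub>m (Suc d) $$ (i, j)"
      using ij W' colW'[OF ij(1)] colW'[OF ij(2)] WW[of i j] orth[of i] uu
      by (auto simp: less_Suc_eq)
  qed (use W' in auto)
  then have "ortho_family r V (Suc d) W'"
    using W' colW' Wd uV by (auto simp: ortho_family_def)
  then show False using ortho_dim_ge[of r V "Suc d" W'] by (simp add: d_def)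
qed

lemma ortho_dim_pos:
  assumes V: "subspace_of r V" and v: "v \<in> V" "v \<noteq> 0\<^sub>v r"
  shows "ortho_dim r V \<ge> 1"
proof (rule ccontr)
  assume "\<not> ?thesis"
  then have 0: "ortho_dim r V = 0" by simp
  obtain W where W: "ortho_family r V (ortho_dim r V) W" by (rule ortho_dim_attained)
  have "W *\<^sub>v (transpose_mat W *\<^sub>v v) = 0\<^sub>v r"
    using W unfolding 0 ortho_family_def by (intro eq_vecI) (auto simp: scalar_prod_def)
  then show False using ortho_family_maximal[OF V W v(1)] v by simp
qed

lemma mult_mat_unit_vec:
  fixes M :: "real mat"
  assumes "M \<in> carrier_mat p q" "j < q"
  shows "M *\<^sub>v unit_vec q j = col M j"
  using assms by (intro eq_vecI) (auto simp: scalar_prod_right_unit)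

text \<open>\<open>E\<close> is an orthonormal basis of the range of \<open>M\<close>, and
  \<open>C\<close> holds the coordinates of the columns of \<open>M\<close> in it. \<open>Z\<close>
  collects preimages of the basis vectors and certifies that \<open>C\<close> has full row
  rank.\<close>

lemma rank_factorization:
  fixes M :: "real mat"
  assumes M: "M \<in> carrier_mat p q"
  obtains d E C Z where "E \<in> carrier_mat p d" "C \<in> carrier_mat d q" "Z \<in> carrier_mat q d"
    "transpose_mat E * E = 1\<^sub>m d" "M = E * C" "E = M * Z" "C * Z = 1\<^sub>m d"
proof -
  define V where "V = {M *\<^sub>v z | z. z \<in> carrier_vec q}"
  have V: "subspace_of p V"
    unfolding subspace_of_def
  proof (intro conjI ballI allI)
    show "V \<subseteq> carrier_vec p" using M by (auto simp: V_def)
    show "0\<^sub>v p \<in> V"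
      unfolding V_def using mult_mat_zero_vec[OF M] by (auto intro!: exI[of _ "0\<^sub>v q"])
    fix x assume "x \<in> V"
    then obtain x' where x': "x' \<in> carrier_vec q" "x = M *\<^sub>v x'" by (auto simp: V_def)
    show "a \<cdot>\<^sub>v x \<in> V" for a
      unfolding V_def using M x' by (auto intro!: exI[of _ "a \<cdot>\<^sub>v x'"] simp: mult_mat_vec[of _ p q])
    fix y assume "y \<in> V"
    then obtain y' where "y' \<in> carrier_vec q" "y = M *\<^sub>v y'" by (auto simp: V_def)
    then show "x + y \<in> V"
      unfolding V_def using M x'
      by (auto intro!: exI[of _ "x' + y'"] simp: mult_add_distrib_mat_vec[of _ p q])
  qed
  define d where "d = ortho_dim p V"
  obtain E where E': "ortho_family p V d E" unfolding d_def by (rule ortho_dim_attained)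
  then have E: "E \<in> carrier_mat p d" "transpose_mat E * E = 1\<^sub>m d" "\<forall>j<d. col E j \<in> V"
    by (auto simp: ortho_family_def)
  then have "\<forall>j<d. \<exists>z. z \<in> carrier_vec q \<and> col E j = M *\<^sub>v z" by (auto simp: V_def)
  then obtain z where z: "\<And>j. j < d \<Longrightarrow> z j \<in> carrier_vec q \<and> col E j = M *\<^sub>v z j" by metis
  define Z where "Z = mat q d (\<lambda>(i, j). z j $ i)"
  have Z: "Z \<in> carrier_mat q d" by (simp add: Z_def)
  have "col Z j = z j" if "j < d" for j using z[OF that] that by (intro eq_vecI) (auto simp: Z_def)
  then have "col (M * Z) j = col E j" if "j < d" for j
    using z[OF that] that col_mult2[OF M Z] by simp
  then have EMZ: "E = M * Z" using M Z E(1) by (intro mat_col_eqI) auto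
  define C where "C = transpose_mat E * M"
  have C: "C \<in> carrier_mat d q" using E M by (auto simp: C_def)
  have "col (E * C) j = col M j" if "j < q" for j
  proof -
    have "col M j = M *\<^sub>v unit_vec q j" using M that by (simp add: mult_mat_unit_vec[OF M])
    then have "col M j \<in> V" unfolding V_def using unit_vec_carrier by blast
    then have "E *\<^sub>v (transpose_mat E *\<^sub>v col M j) = col M j"
      using ortho_family_maximal[OF V] E' d_def by blast
    moreover have "col C j = transpose_mat E *\<^sub>v col M j"
      unfolding C_def using E M that by (intro col_mult2) auto
    ultimately show ?thesis using col_mult2[OF E(1) C that] by simp
  qed
  then have MEC: "M = E * C" using M E C by (intro mat_col_eqI) auto
  have "C * Z = transpose_mat E * (M * Z)" unfolding C_def using E M Z by (intro assoc_mult_mat) auto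
  then have "C * Z = 1\<^sub>m d" using E EMZ by simp
  then show ?thesis using that[OF E(1) C Z E(2) MEC EMZ] by simp
qed

section \<open>Submatrices, pseudoinverses and column selection\<close>

lemma mult_rows_of_eq_0_iff:
  fixes X :: "real mat"
  assumes X: "X \<in> carrier_mat n k" and v: "v \<in> carrier_vec k"
  shows "rows_of X I *\<^sub>v v = 0\<^sub>v (dim_row (rows_of X I)) \<longleftrightarrow> (\<forall>i\<in>I. i < n \<longrightarrow> row X i \<bullet> v = 0)"
proof -
  let ?N = "card {i. i < n \<and> i \<in> I}"
  have dr: "dim_row (rows_of X I) = ?N" using X by (simp add: dim_submatrix)
  have rw: "row (rows_of X I) c = row X (pick I c)" if "c < ?N" for c
    using X that pick_le[OF that] by (intro eq_vecI) (auto simp: submatrix_def pick_UNIV)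
  have pk: "pick I c \<in> I \<and> pick I c < n" if "c < ?N" for c
  proof
    show "pick I c < n" by (rule pick_le[OF that])
    show "pick I c \<in> I"
    proof (cases "finite I")
      case True
      then have "?N \<le> card I" by (intro card_mono) auto
      then show ?thesis using that pick_in_set_le by simp
    qed (simp add: pick_in_set_inf)
  qed
  have ix: "\<exists>c<?N. pick I c = i" if "i \<in> I" "i < n" for i
  proof (intro exI conjI)
    show "pick I (card {a\<in>I. a < i}) = i" by (rule pick_card_in_set[OF that(1)])
    have "{a \<in> I. a < i} \<subset> {i. i < n \<and> i \<in> I}" using that by auto
    then show "card {a\<in>I. a < i} < ?N" by (simp add: psubset_card_mono)
  qed
  have "rows_of X I *\<^sub>v v = 0\<^sub>v (dim_row (rows_of X I)) \<longleftrightarrow>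
      (\<forall>c<?N. row (rows_of X I) c \<bullet> v = 0)"
    by (auto simp: vec_eq_iff dr)
  also have "\<dots> \<longleftrightarrow> (\<forall>c<?N. row X (pick I c) \<bullet> v = 0)" using rw by auto
  also have "\<dots> \<longleftrightarrow> (\<forall>i\<in>I. i < n \<longrightarrow> row X i \<bullet> v = 0)" using pk ix by metis
  finally show ?thesis .
qed

text \<open>Phrased by indices, not by the submatrix, so that unions of index sets and splittings
  into column blocks are easy to handle. Members of \<open>I\<close> beyond the row count are
  ignored, as in \<open>submatrix\<close>.\<close>

definition rows_injective :: "real mat \<Rightarrow> nat set \<Rightarrow> bool" where
  "rows_injective X I \<longleftrightarrow> (\<forall>v\<in>carrier_vec (dim_col X).
     (\<forall>i\<in>I. i < dim_row X \<longrightarrow> row X i \<bullet> v = 0) \<longrightarrow> v = 0\<^sub>v (dim_col X))"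

lemma rows_injectiveI:
  assumes "X \<in> carrier_mat n k"
    "\<And>v. v \<in> carrier_vec k \<Longrightarrow> (\<And>i. i \<in> I \<Longrightarrow> i < n \<Longrightarrow> row X i \<bullet> v = 0) \<Longrightarrow> v = 0\<^sub>v k"
  shows "rows_injective X I"
  using assms unfolding rows_injective_def by auto

lemma rows_injectiveD:
  assumes "rows_injective X I" "X \<in> carrier_mat n k" "v \<in> carrier_vec k"
    "\<And>i. i \<in> I \<Longrightarrow> i < n \<Longrightarrow> row X i \<bullet> v = 0"
  shows "v = 0\<^sub>v k"
  using assms unfolding rows_injective_def by auto

lemma rows_injective_iff: "rows_injective X I \<longleftrightarrow> injective_mat (rows_of X I)"
  using mult_rows_of_eq_0_iff[of X "dim_row X" "dim_col X" _ I]
  unfolding rows_injective_def injective_mat_def by (simp add: dim_submatrix)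

lemma rows_injective_imp_injective:
  assumes X: "X \<in> carrier_mat n k" and "rows_injective X I"
  shows "injective_mat X"
proof (rule injective_matI[OF X])
  fix v assume v: "v \<in> carrier_vec k" "X *\<^sub>v v = 0\<^sub>v n"
  have "row X i \<bullet> v = 0" if "i < n" for i
    using arg_cong[OF v(2), of "\<lambda>x. x $ i"] that X by simp
  then show "v = 0\<^sub>v k" using rows_injectiveD[OF assms(2) X v(1)] by blast
qed

lemma rows_of_mult:
  fixes P R :: "real mat"
  assumes P: "P \<in> carrier_mat n k" and R: "R \<in> carrier_mat k m"
  shows "rows_of (P * R) I = rows_of P I * R"
proof (rule eq_matI)
  fix i j assume "i < dim_row (rows_of P I * R)" "j < dim_col (rows_of P I * R)"
  then have i: "i < card {i. i < n \<and> i \<in> I}" and j: "j < m"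
    using P R by (auto simp: dim_submatrix)
  have "row (rows_of P I) i = row P (pick I i)"
    using P i pick_le[OF i] by (intro eq_vecI) (auto simp: submatrix_def pick_UNIV)
  then show "rows_of (P * R) I $$ (i, j) = (rows_of P I * R) $$ (i, j)"
    using P R i j pick_le[OF i] by (simp add: submatrix_index pick_UNIV dim_submatrix)
qed (use P R in \<open>auto simp: dim_submatrix\<close>)

lemma cols_of_eq_transpose: "cols_of M J = transpose_mat (rows_of (transpose_mat M) J)"
proof (rule eq_matI)
  fix i j assume "i < dim_row (transpose_mat (rows_of (transpose_mat M) J))"
    "j < dim_col (transpose_mat (rows_of (transpose_mat M) J))"
  then have ij: "i < dim_row M" "j < card {j. j < dim_col M \<and> j \<in> J}" by (auto simp: dim_submatrix)
  then show "cols_of M J $$ (i, j) = transpose_mat (rows_of (transpose_mat M) J) $$ (i, j)"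
    using pick_le[OF ij(2)] by (simp add: submatrix_def pick_UNIV)
qed (auto simp: dim_submatrix)

text \<open>\<open>L\<close> is (M^T M)^(-1) M^T, so \<open>M * L\<close> is the orthogonal
  projection onto the range of \<open>M\<close>.\<close>

lemma injective_left_inverse:
  assumes M: "M \<in> carrier_mat p q" and "injective_mat M"
  obtains L where "L \<in> carrier_mat q p" "L * M = 1\<^sub>m q" "transpose_mat (M * L) = M * L"
proof -
  let ?G = "transpose_mat M * M"
  have G: "?G \<in> carrier_mat q q" using M by auto
  have tG: "transpose_mat ?G = ?G" using M by (simp add: transpose_mult[of _ q p _ q])
  obtain H where H: "H \<in> carrier_mat q q" "?G * H = 1\<^sub>m q" "H * ?G = 1\<^sub>m q"
    using invertible_of_det[OF G] injective_iff_det_gram[OF M] assms(2) by auto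
  have "transpose_mat H * ?G = 1\<^sub>m q"
    using transpose_mult[OF G H(1)] H(2) tG by simp
  have "transpose_mat H = transpose_mat H * (?G * H)" using H by simp
  also have "\<dots> = (transpose_mat H * ?G) * H"
    using H(1) G by (intro assoc_mult_mat[symmetric]) auto
  also have "\<dots> = H" using \<open>transpose_mat H * ?G = 1\<^sub>m q\<close> H(1) by simp
  finally have tH: "transpose_mat H = H" .
  define L where "L = H * transpose_mat M"
  have L: "L \<in> carrier_mat q p" using H M by (auto simp: L_def)
  have "L * M = H * ?G" unfolding L_def using H(1) M by (intro assoc_mult_mat) auto
  then have "L * M = 1\<^sub>m q" using H by simp
  moreover have "transpose_mat (M * L) = M * L"
  proof -
    have "transpose_mat L = M * H"
      unfolding L_def using H(1) M by (subst transpose_mult[of _ q q _ p]) (auto simp: tH)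
    then have "transpose_mat (M * L) = (M * H) * transpose_mat M"
      using transpose_mult[OF M L] by simp
    also have "\<dots> = M * L" unfolding L_def using H(1) M by (intro assoc_mult_mat) auto
    finally show ?thesis .
  qed
  ultimately show ?thesis using that L by blast
qed

text \<open>Gives meaning to the definite description in \<open>pinv\<close>. The symmetric
  projections \<open>A * B\<close> and \<open>A * C\<close> absorb each other, so transposing a
  product of the two shows them equal; likewise on the other side.\<close>

lemma is_pinv_unique:
  assumes B: "is_pinv A B" and C: "is_pinv A C"
  shows "B = C"
proof -
  obtain p q where A: "A \<in> carrier_mat p q" by blast
  have Bc: "B \<in> carrier_mat q p" and Cc: "C \<in> carrier_mat q p"
    using A B C by (auto simp: is_pinv_def)
  have AB: "A * B \<in> carrier_mat p p" and AC: "A * C \<in> carrier_mat p p"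
    and BA: "B * A \<in> carrier_mat q q" and CA: "C * A \<in> carrier_mat q q" using A Bc Cc by auto
  have b: "A * B * A = A" "B * A * B = B" "transpose_mat (A * B) = A * B" "transpose_mat (B * A) = B * A"
    and c: "A * C * A = A" "C * A * C = C" "transpose_mat (A * C) = A * C" "transpose_mat (C * A) = C * A"
    using B C by (auto simp: is_pinv_def)
  have 1: "(A * B) * (A * C) = A * C" "(A * C) * (A * B) = A * B"
    using assoc_mult_mat[OF AB A Cc] assoc_mult_mat[OF AC A Bc] b c by auto
  have "A * C = transpose_mat ((A * B) * (A * C))" using 1 c by simp
  also have "\<dots> = (A * C) * (A * B)" using transpose_mult[OF AB AC] b c by simp
  finally have eq1: "A * C = A * B" using 1 by simp
  have "A * (C * A) = A" "A * (B * A) = A"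
    using assoc_mult_mat[OF A Cc A] assoc_mult_mat[OF A Bc A] b c by auto
  then have 2: "(B * A) * (C * A) = B * A" "(C * A) * (B * A) = C * A"
    using assoc_mult_mat[OF Bc A CA] assoc_mult_mat[OF Cc A BA] by auto
  have "B * A = transpose_mat ((B * A) * (C * A))" using 2 b by simp
  also have "\<dots> = (C * A) * (B * A)" using transpose_mult[OF BA CA] b c by simp
  finally have eq2: "B * A = C * A" using 2 by simp
  have "B = C * A * B" using b eq2 by simp
  also have "\<dots> = C * (A * C)" using assoc_mult_mat[OF Cc A Bc] eq1 by simp
  also have "\<dots> = C" using assoc_mult_mat[OF Cc A Cc] c by simp
  finally show ?thesis .
qed

text \<open>For a full-rank factorization the Penrose equations are solved by \<open>R * L\<close>,
  a right inverse of \<open>G\<close> times a left inverse of \<open>F\<close>, both chosen so that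
  the resulting projections \<open>F * L\<close> and \<open>R * G\<close> are symmetric.\<close>

lemma is_pinv_pinv:
  assumes F: "F \<in> carrier_mat p k" "injective_mat F"
    and G: "G \<in> carrier_mat k q" "injective_mat (transpose_mat G)"
  shows "is_pinv (F * G) (pinv (F * G))"
proof -
  obtain L where L: "L \<in> carrier_mat k p" "L * F = 1\<^sub>m k" "transpose_mat (F * L) = F * L"
    using injective_left_inverse[OF F] .
  have Gt: "transpose_mat G \<in> carrier_mat q k" using G by auto
  obtain R' where R': "R' \<in> carrier_mat k q" "R' * transpose_mat G = 1\<^sub>m k"
    "transpose_mat (transpose_mat G * R') = transpose_mat G * R'"
    using injective_left_inverse[OF Gt G(2)] .
  define R where "R = transpose_mat R'"
  have R: "R \<in> carrier_mat q k" using R' by (auto simp: R_def)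
  have GR: "G * R = 1\<^sub>m k"
    using transpose_mult[OF R'(1) Gt] R'(2) by (simp add: R_def)
  have RG: "transpose_mat (R * G) = R * G"
    using transpose_mult[OF Gt R'(1)] R'(3) by (simp add: R_def)
  have FG: "F * G \<in> carrier_mat p q" and RL: "R * L \<in> carrier_mat q p"
    and GRL: "G * (R * L) = L" and RLF: "(R * L) * F = R"
    using F(1) G(1) R L assoc_mult_mat[OF G(1) R L(1)] assoc_mult_mat[OF R L(1) F(1)] GR
    by auto
  have AB: "F * G * (R * L) = F * L" using assoc_mult_mat[OF F(1) G(1) RL] GRL by simp
  have BA: "(R * L) * (F * G) = R * G" using assoc_mult_mat[OF RL F(1) G(1)] RLF by simp
  have "F * L * (F * G) = F * (L * (F * G))" using F L G by (intro assoc_mult_mat) auto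
  also have "L * (F * G) = G" using assoc_mult_mat[OF L(1) F(1) G(1)] L G by simp
  finally have ABA: "F * L * (F * G) = F * G" .
  have "R * G * (R * L) = R * (G * (R * L))" using R G RL by (intro assoc_mult_mat) auto
  then have BAB: "R * G * (R * L) = R * L" using GRL by simp
  have "is_pinv (F * G) (R * L)"
    unfolding is_pinv_def using F(1) G(1) RL AB BA ABA BAB L(3) RG by auto
  then show ?thesis
    unfolding pinv_def by (rule theI) (rule is_pinv_unique[OF _ \<open>is_pinv (F * G) (R * L)\<close>])
qed

text \<open>Full rank of \<open>Y\<close> on \<open>J\<close> makes every column of \<open>A\<close>
  a combination of the selected ones, with coefficients \<open>W\<close>; the projection onto their
  span therefore fixes \<open>A\<close>.\<close>

lemma col_projection:
  assumes X: "X \<in> carrier_mat n k" "injective_mat X" and Y: "Y \<in> carrier_mat m k"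
    and J: "rows_injective Y J" and A: "A = X * transpose_mat Y"
  shows "cols_of A J * pinv (cols_of A J) * A = A"
    "pinv (cols_of A J) \<in> carrier_mat (dim_col (cols_of A J)) n"
proof -
  define q where "q = card {i. i < m \<and> i \<in> J}"
  define YJ where "YJ = rows_of Y J"
  have YJ: "YJ \<in> carrier_mat q k" "injective_mat YJ"
    using Y J by (auto simp: YJ_def q_def submatrix_def rows_injective_iff)
  have "transpose_mat A = Y * transpose_mat X"
    unfolding A using X Y by (subst transpose_mult[of _ n k _ m]) auto
  then have "rows_of (transpose_mat A) J = YJ * transpose_mat X"
    using rows_of_mult[of Y m k "transpose_mat X" n J] X Y by (simp add: YJ_def)
  then have C: "cols_of A J = X * transpose_mat YJ"
    unfolding cols_of_eq_transpose using X YJ by (simp add: transpose_mult[of _ q k _ n])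
  define P where "P = pinv (cols_of A J)"
  have pv: "is_pinv (cols_of A J) P"
    unfolding P_def C using X YJ by (intro is_pinv_pinv) auto
  have Cc: "cols_of A J \<in> carrier_mat n q" unfolding C using X YJ by auto
  have P: "P \<in> carrier_mat q n" using pv Cc by (auto simp: is_pinv_def)
  then show "pinv (cols_of A J) \<in> carrier_mat (dim_col (cols_of A J)) n"
    using Cc by (auto simp: P_def)
  obtain L where L: "L \<in> carrier_mat k q" "L * YJ = 1\<^sub>m k"
    using injective_left_inverse[OF YJ] by blast
  define W where "W = transpose_mat L * transpose_mat Y"
  have W: "W \<in> carrier_mat q m" using L Y by (auto simp: W_def)
  have "transpose_mat YJ * transpose_mat L = 1\<^sub>m k"
    using transpose_mult[OF L(1) YJ(1)] L(2) by simp
  moreover have "transpose_mat YJ * W = transpose_mat YJ * transpose_mat L * transpose_mat Y"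
    unfolding W_def using YJ L Y by (intro assoc_mult_mat[symmetric]) auto
  ultimately have "transpose_mat YJ * W = transpose_mat Y" using Y by simp
  moreover have "cols_of A J * W = X * (transpose_mat YJ * W)"
    unfolding C using X YJ W by (intro assoc_mult_mat) auto
  ultimately have CW: "A = cols_of A J * W" using A by simp
  have "cols_of A J * P * A = cols_of A J * P * (cols_of A J * W)" using CW by simp
  also have "\<dots> = (cols_of A J * P * cols_of A J) * W"
    using Cc P W by (intro assoc_mult_mat[symmetric]) auto
  also have "\<dots> = A" using pv CW by (simp add: is_pinv_def)
  finally show "cols_of A J * pinv (cols_of A J) * A = A" by (simp add: P_def)
qed

lemma row_projection:
  assumes X: "X \<in> carrier_mat n k" and Y: "Y \<in> carrier_mat m k" "injective_mat Y"
    and I: "rows_injective X I" and A: "A = X * transpose_mat Y"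
  shows "A * pinv (rows_of A I) * rows_of A I = A"
proof -
  define p where "p = card {i. i < n \<and> i \<in> I}"
  define XI where "XI = rows_of X I"
  have XI: "XI \<in> carrier_mat p k" "injective_mat XI"
    using X I by (auto simp: XI_def p_def submatrix_def rows_injective_iff)
  have R: "rows_of A I = XI * transpose_mat Y"
    unfolding A XI_def using X Y by (intro rows_of_mult) auto
  define P where "P = pinv (rows_of A I)"
  have pv: "is_pinv (rows_of A I) P"
    unfolding P_def R using Y XI by (intro is_pinv_pinv) auto
  have Rc: "rows_of A I \<in> carrier_mat p m" unfolding R using Y XI by auto
  have P: "P \<in> carrier_mat m p" using pv Rc by (auto simp: is_pinv_def)
  obtain L where L: "L \<in> carrier_mat k p" "L * XI = 1\<^sub>m k"
    using injective_left_inverse[OF XI] by blast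
  have XL: "X * L \<in> carrier_mat n p" using X L by auto
  have "(X * L) * XI = X * (L * XI)" using X L XI by (intro assoc_mult_mat) auto
  then have "(X * L) * XI = X" using L X by simp
  moreover have "(X * L) * rows_of A I = (X * L) * XI * transpose_mat Y"
    unfolding R using XL XI Y by (intro assoc_mult_mat[symmetric]) auto
  ultimately have WR: "A = (X * L) * rows_of A I" using A by simp
  have RP: "rows_of A I * P \<in> carrier_mat p p" using Rc P by auto
  have "A * P * rows_of A I = (X * L) * rows_of A I * P * rows_of A I" using WR by simp
  also have "(X * L) * rows_of A I * P = (X * L) * (rows_of A I * P)"
    using XL Rc P by (intro assoc_mult_mat) auto
  also have "\<dots> * rows_of A I = (X * L) * (rows_of A I * P * rows_of A I)"
    using XL Rc RP by (intro assoc_mult_mat) auto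
  also have "\<dots> = A" using pv WR by (simp add: is_pinv_def)
  finally show ?thesis by (simp add: P_def)
qed

lemma skeleton_exact:
  assumes X: "X \<in> carrier_mat n k" and Z: "Z \<in> carrier_mat k k" "injective_mat Z"
    and Y: "Y \<in> carrier_mat m k"
    and A: "A = X * Z * transpose_mat Y"
    and I: "rows_injective X I" and J: "rows_injective Y J"
  shows "A = cols_of A J * pinv (cols_of A J) * A * pinv (rows_of A I) * rows_of A I"
proof -
  have Xi: "injective_mat X" and Yi: "injective_mat Y"
    using rows_injective_imp_injective X Y I J by auto
  have "det Z \<noteq> 0" using Z injective_square_iff_det by blast
  then have Zt: "injective_mat (transpose_mat Z)"
    using injective_square_iff_det[of "transpose_mat Z" k] det_transpose[OF Z(1)] Z(1) by simp
  \<comment> \<open>The middle factor is absorbed on the left for the columns and on the right for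
    the rows, so that each projection sees a product of two full-rank factors.\<close>
  have XZ: "X * Z \<in> carrier_mat n k" "injective_mat (X * Z)"
    using X Z injective_mat_mult[OF Xi Z(2) X Z(1)] by auto
  have YZ: "Y * transpose_mat Z \<in> carrier_mat m k" "injective_mat (Y * transpose_mat Z)"
    using Y Z injective_mat_mult[OF Yi Zt Y] by auto
  have "A = X * (Z * transpose_mat Y)" unfolding A using X Z Y by (intro assoc_mult_mat) auto
  also have "Z * transpose_mat Y = transpose_mat (Y * transpose_mat Z)"
    using Y Z by (subst transpose_mult[of _ m k _ k]) auto
  finally have A': "A = X * transpose_mat (Y * transpose_mat Z)" .
  have "cols_of A J * pinv (cols_of A J) * A = A"
    by (rule col_projection(1)[OF XZ Y J A])
  then show ?thesis using row_projection[OF X YZ I A'] by simp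
qed

text \<open>The lower bound on the singular values of the leading block keeps its rank at the rank
  of \<open>M\<close>, so the selected columns span the range of \<open>M\<close>.\<close>

lemma srrqr_columns_span:
  assumes M: "M \<in> carrier_mat p q" and S: "srrqr_columns M k S"
    and B: "B \<in> carrier_mat p k" and D: "D \<in> carrier_mat k q" and MBD: "M = B * D"
    and u: "u \<in> carrier_vec p" "\<And>j. j \<in> S \<Longrightarrow> j < q \<Longrightarrow> col M j \<bullet> u = 0"
  shows "transpose_mat M *\<^sub>v u = 0\<^sub>v q"
proof -
  obtain \<pi> Q Ar Br Cr where sq: "srrqr M k \<pi> Q Ar Br Cr" and S': "S = \<pi> ` {..<k}"
    using S by (auto simp: srrqr_columns_def)
  have dims: "dim_row M = p" "dim_col M = q" using M by auto
  have k: "k \<le> p" "k \<le> q" and pm: "\<pi> permutes {..<q}" and Q: "Q \<in> carrier_mat p p" "orthonormal_cols Q"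
    and blk: "Ar \<in> carrier_mat k k" "Br \<in> carrier_mat k (q - k)" "Cr \<in> carrier_mat (p - k) (q - k)"
    and fac: "M * perm_matrix q \<pi> = Q * four_block_mat Ar Br (0\<^sub>m (p - k) k) Cr"
    and sv: "\<And>i. i \<in> {1..k} \<Longrightarrow> singular_value Ar i \<ge> singular_value M i / sqrt (1 + real (k * (q - k)))"
    using sq unfolding srrqr_def Let_def dims by auto
  obtain d E C Z where E: "E \<in> carrier_mat p d" and C: "C \<in> carrier_mat d q" and Z: "Z \<in> carrier_mat q d"
    and EE: "transpose_mat E * E = 1\<^sub>m d" and MEC: "M = E * C" and EMZ: "E = M * Z" and CZ: "C * Z = 1\<^sub>m d"
    using rank_factorization[OF M] .
  have Ei: "injective_mat E" using E EE by (intro left_inverse_imp_injective[of E p d "transpose_mat E"]) auto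
  \<comment> \<open>The inner dimension \<open>k\<close> of \<open>B * D\<close> bounds the rank
    \<open>d\<close>, so the leading block is large enough to carry the whole rank.\<close>
  have "E = B * (D * Z)" unfolding EMZ MBD using B D Z by (intro assoc_mult_mat) auto
  then have "injective_mat (D * Z)"
    using Ei B D Z by (intro injective_mat_right[of B "D * Z" p k d]) auto
  then have dk: "d \<le> k" using D Z by (intro injective_mat_dim_le[of "D * Z"]) auto
  define w where "w = transpose_mat E *\<^sub>v u"
  have w: "w \<in> carrier_vec d" using E u by (auto simp: w_def)
  have \<pi>: "\<pi> j < q" if "j < q" for j using permutes_in_image[OF pm, of j] that by simp
  have "w = 0\<^sub>v d"
  proof (cases "d = 0")
    case True
    then show ?thesis using w by (intro eq_vecI) auto
  next
    case False
    then have d1: "1 \<le> d" by simp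
    have "transpose_mat Z * transpose_mat C = 1\<^sub>m d" using transpose_mult[OF C Z] CZ by simp
    then have "injective_mat (transpose_mat C)"
      using C Z by (intro left_inverse_imp_injective[of _ q d "transpose_mat Z"]) auto
    then have "det (C * transpose_mat C) \<noteq> 0"
      using injective_iff_det_gram[of "transpose_mat C" q d] C by simp
    \<comment> \<open>\<open>E\<close> has Gram matrix 1 and \<open>C\<close> has full row rank. The
      guarantee for \<open>Ar\<close> only divides by a positive number, so positivity
      survives.\<close>
    then have "singular_value M d > 0"
      unfolding MEC using singular_value_pos_iff_det[OF E C d1] dk k by (simp add: EE)
    then have "singular_value M d / sqrt (1 + real (k * (q - k))) > 0"
      by (intro divide_pos_pos) (auto intro: add_pos_nonneg)
    then have svA: "singular_value Ar d > 0" using sv[of d] d1 dk by simp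
    \<comment> \<open>\<open>C\<pi>\<close> holds the coordinate columns of the selected indices and
      \<open>T\<close> the first \<open>k\<close> rows of the transpose of \<open>Q\<close>. Then
      \<open>Ar\<close> factors as \<open>(T * E) * C\<pi>\<close>, and the determinant criterion,
      read in the other direction, gives \<open>C\<pi>\<close> full row rank.\<close>
    define C\<pi> where "C\<pi> = mat d k (\<lambda>(i, j). C $$ (i, \<pi> j))"
    define T where "T = mat k p (\<lambda>(i, j). Q $$ (j, i))"
    have C\<pi>: "C\<pi> \<in> carrier_mat d k" and T: "T \<in> carrier_mat k p" by (auto simp: C\<pi>_def T_def)
    have colC: "col C\<pi> j = col C (\<pi> j)" if "j < k" for j
      using that C \<pi>[of j] k by (intro eq_vecI) (auto simp: C\<pi>_def)
    let ?N = "four_block_mat Ar Br (0\<^sub>m (p - k) k) Cr"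
    have N: "?N \<in> carrier_mat p q"
      using four_block_carrier_mat[OF blk(1) blk(3), of Br "0\<^sub>m (p - k) k"] k by simp
    have pmc: "perm_matrix q \<pi> \<in> carrier_mat q q" by (simp add: perm_matrix_def)
    have colMp: "col (M * perm_matrix q \<pi>) j = col M (\<pi> j)" if "j < q" for j
    proof -
      have "col (perm_matrix q \<pi>) j = unit_vec q (\<pi> j)"
        using that \<pi>[OF that] by (intro eq_vecI) (auto simp: perm_matrix_def)
      then show ?thesis using col_mult2[OF M pmc that] mult_mat_unit_vec[OF M \<pi>[OF that]] by simp
    qed
    have tQ: "transpose_mat Q * Q = 1\<^sub>m p" using Q by (simp add: orthonormal_cols_def)
    have "?N = transpose_mat Q * (Q * ?N)"
      using assoc_mult_mat[of "transpose_mat Q" p p Q p ?N q] Q(1) N tQ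
        left_mult_one_mat[OF N] by (metis transpose_carrier_mat)
    then have NQ: "?N = transpose_mat Q * (M * perm_matrix q \<pi>)" using fac by simp
    have "Ar = T * (E * C\<pi>)"
    proof (rule eq_matI)
      fix i j assume "i < dim_row (T * (E * C\<pi>))" "j < dim_col (T * (E * C\<pi>))"
      then have ij: "i < k" "j < k" using T C\<pi> by auto
      then have jq: "j < q" and ip: "i < p" using k by auto
      have "Ar $$ (i, j) = ?N $$ (i, j)" using ij blk by simp
      also have "\<dots> = (transpose_mat Q * (M * perm_matrix q \<pi>)) $$ (i, j)" using NQ by simp
      also have "\<dots> = row (transpose_mat Q) i \<bullet> col (M * perm_matrix q \<pi>) j"
        using Q ip jq M pmc by simp
      also have "row (transpose_mat Q) i = row T i"
        using Q ip ij by (intro eq_vecI) (auto simp: T_def)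
      also have "col (M * perm_matrix q \<pi>) j = E *\<^sub>v col C\<pi> j"
        using colMp[OF jq] col_mult2[OF E C \<pi>[OF jq]] colC[OF ij(2)] by (simp add: MEC)
      also have "\<dots> = col (E * C\<pi>) j" using col_mult2[OF E C\<pi> ij(2)] by simp
      finally show "Ar $$ (i, j) = (T * (E * C\<pi>)) $$ (i, j)" using ij T E C\<pi> by simp
    qed (use blk T C\<pi> in auto)
    also have "\<dots> = (T * E) * C\<pi>" using T E C\<pi> by (intro assoc_mult_mat[symmetric]) auto
    finally have ArTE: "Ar = (T * E) * C\<pi>" .
    have TE: "T * E \<in> carrier_mat k d" using T E by auto
    have "det (C\<pi> * transpose_mat C\<pi>) \<noteq> 0"
      using singular_value_pos_iff_det[OF TE C\<pi> d1 dk] svA ArTE by simp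
    then have i\<pi>: "injective_mat (transpose_mat C\<pi>)"
      using injective_iff_det_gram[of "transpose_mat C\<pi>" k d] C\<pi> by simp
    \<comment> \<open>Orthogonality of \<open>u\<close> to a selected column of \<open>M\<close> is
      orthogonality of its coordinates \<open>w\<close> to the matching column of
      \<open>C\<pi>\<close>, and these columns span all coordinates.\<close>
    have "transpose_mat C\<pi> *\<^sub>v w = 0\<^sub>v k"
    proof (rule eq_vecI)
      fix j assume "j < dim_vec (0\<^sub>v k :: real vec)"
      then have j: "j < k" by simp
      then have jq: "j < q" using k by simp
      have cc: "col C (\<pi> j) \<in> carrier_vec d" using C \<pi>[OF jq] by auto
      have "(transpose_mat C\<pi> *\<^sub>v w) $ j = col C (\<pi> j) \<bullet> w" using j C\<pi> colC[OF j] by simp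
      also have "\<dots> = w \<bullet> col C (\<pi> j)" using cc w by (intro comm_scalar_prod) auto
      also have "\<dots> = u \<bullet> (E *\<^sub>v col C (\<pi> j))"
        unfolding w_def using scalar_prod_transpose_mult[OF E cc u(1)] by simp
      also have "E *\<^sub>v col C (\<pi> j) = col M (\<pi> j)" using col_mult2[OF E C \<pi>[OF jq]] by (simp add: MEC)
      also have "u \<bullet> col M (\<pi> j) = col M (\<pi> j) \<bullet> u" using u M \<pi>[OF jq] by (intro comm_scalar_prod[of _ p]) auto
      also have "\<dots> = 0" using u(2)[of "\<pi> j"] \<pi>[OF jq] j S' by simp
      finally show "(transpose_mat C\<pi> *\<^sub>v w) $ j = 0\<^sub>v k $ j" using j by simp
    qed (use C\<pi> in auto)
    then show ?thesis using injective_matD[OF i\<pi>, of k d w] C\<pi> w by simp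
  qed
  have "transpose_mat M *\<^sub>v u = (transpose_mat C * transpose_mat E) *\<^sub>v u"
    using transpose_mult[OF E C] by (simp add: MEC)
  also have "\<dots> = transpose_mat C *\<^sub>v w"
    unfolding w_def using C E u by (intro assoc_mult_mat_vec) auto
  also have "\<dots> = 0\<^sub>v q" using \<open>w = 0\<^sub>v d\<close> C by (simp add: mult_mat_zero_vec[of _ q d])
  finally show ?thesis .
qed

section \<open>Sampling rows of a matrix with orthonormal columns\<close>

text \<open>Double counting: each \<open>T\<close> of size \<open>t + 1\<close> arises from exactly
  \<open>t + 1\<close> pairs \<open>(S, i)\<close>.\<close>

lemma sum_subsets_insert:
  fixes f :: "nat set \<Rightarrow> real"
  shows "(\<Sum>S | S \<subseteq> {..<n} \<and> card S = t. \<Sum>i\<in>{..<n} - S. f (insert i S)) =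
    real (Suc t) * (\<Sum>T | T \<subseteq> {..<n} \<and> card T = Suc t. f T)"
proof -
  let ?sub = "\<lambda>t. {S. S \<subseteq> {..<n} \<and> card S = t}"
  have fin: "finite (?sub s)" for s by (rule finite_subset[of _ "Pow {..<n}"]) auto
  have finS: "finite S" if "S \<subseteq> {..<n}" for S using that by (rule finite_subset) simp
  have "(\<Sum>S\<in>?sub t. \<Sum>i\<in>{..<n} - S. f (insert i S)) =
      (\<Sum>(S, i)\<in>(SIGMA S:?sub t. {..<n} - S). f (insert i S))"
    using fin by (intro sum.Sigma) auto
  also have "\<dots> = (\<Sum>(T, i)\<in>(SIGMA T:?sub (Suc t). T). f T)"
    by (rule sum.reindex_bij_witness[where i = "\<lambda>(T, i). (T - {i}, i)" and j = "\<lambda>(S, i). (insert i S, i)"])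
      (auto simp: finS insert_absorb card_insert_if)
  also have "\<dots> = (\<Sum>T\<in>?sub (Suc t). \<Sum>i\<in>T. f T)"
    using fin finS by (intro sum.Sigma[symmetric]) auto
  also have "\<dots> = (\<Sum>T\<in>?sub (Suc t). real (Suc t) * f T)"
    by (intro sum.cong) auto
  also have "\<dots> = real (Suc t) * (\<Sum>T\<in>?sub (Suc t). f T)" by (simp add: sum_distrib_left)
  finally show ?thesis .
qed

text \<open>Sampling without replacement, one element at a time: a uniform new element shrinks the
  mean of \<open>f\<close> by a factor of at most 1 - c / (n - t), hence at most exp (- c / n).
  Summing over all subsets of each size avoids a random order of the sample.\<close>

lemma sum_subsets_le:
  fixes f :: "nat set \<Rightarrow> real"
  assumes nonneg: "\<And>S. f S \<ge> 0" and c: "c \<ge> 0"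
    and step: "\<And>S. S \<subseteq> {..<n} \<Longrightarrow> card S < n \<Longrightarrow>
      (\<Sum>i\<in>{..<n} - S. f (insert i S)) \<le> (real (n - card S) - c) * f S"
    and "t \<le> n"
  shows "(\<Sum>S | S \<subseteq> {..<n} \<and> card S = t. f S) \<le> real (n choose t) * f {} * exp (- c * real t / real n)"
  using \<open>t \<le> n\<close>
proof (induction t)
  case 0
  have "{S. S \<subseteq> {..<n} \<and> card S = 0} = {{}}"
    using finite_subset[OF _ finite_lessThan] by auto
  then show ?case by simp
next
  case (Suc t)
  let ?a = "\<lambda>t. \<Sum>S | S \<subseteq> {..<n} \<and> card S = t. f S"
  have n: "n > 0" "t < n" using Suc.prems by auto
  have bin: "Suc t * (n choose Suc t) = (n - t) * (n choose t)"
    using times_binomial_minus1_eq[of "Suc t" n] binomial_absorb_comp[of n t] by simp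
  have "real (Suc t) * ?a (Suc t) = (\<Sum>S | S \<subseteq> {..<n} \<and> card S = t. \<Sum>i\<in>{..<n} - S. f (insert i S))"
    by (rule sum_subsets_insert[symmetric])
  also have "\<dots> \<le> (\<Sum>S | S \<subseteq> {..<n} \<and> card S = t. (real (n - t) - c) * f S)"
    using step n by (intro sum_mono) auto
  also have "\<dots> = (real (n - t) - c) * ?a t" by (simp add: sum_distrib_left)
  also have "\<dots> \<le> (real (n - t) * (1 - c / real n)) * ?a t"
  proof (rule mult_right_mono)
    have "real (n - t) * c \<le> real n * c" using c by (intro mult_right_mono) auto
    then show "real (n - t) - c \<le> real (n - t) * (1 - c / real n)"
      using n by (simp add: field_simps)
  qed (intro sum_nonneg nonneg)
  also have "\<dots> \<le> (real (n - t) * exp (- c / real n)) * ?a t"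
    using exp_ge_add_one_self[of "- c / real n"]
    by (intro mult_right_mono mult_left_mono sum_nonneg nonneg) auto
  also have "\<dots> \<le> (real (n - t) * exp (- c / real n)) *
      (real (n choose t) * f {} * exp (- c * real t / real n))"
    using Suc by (intro mult_left_mono) auto
  also have "\<dots> = real ((n - t) * (n choose t)) * f {} * (exp (- c / real n) * exp (- c * real t / real n))"
    by (simp only: of_nat_mult mult_ac)
  also have "exp (- c / real n) * exp (- c * real t / real n) = exp (- c * real (Suc t) / real n)"
    using n by (simp add: exp_add[symmetric] field_simps)
  also have "real ((n - t) * (n choose t)) = real (Suc t) * real (n choose Suc t)"
    using bin by (metis of_nat_mult)
  finally show ?case by (simp add: mult.assoc)
qed

text \<open>For a maximal orthonormal family \<open>W\<close> in \<open>V\<close>, the squared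
  entries of \<open>U * W\<close> sum to the number of its columns. A row of \<open>U\<close>
  orthogonal to \<open>V\<close> contributes nothing, any other at most its own squared length, by
  Bessel.\<close>

lemma ortho_dim_le_hits:
  assumes U: "U \<in> carrier_mat n r" "transpose_mat U * U = 1\<^sub>m r"
    and R: "\<And>i. i < n \<Longrightarrow> row U i \<bullet> row U i \<le> R" and Vr: "V \<subseteq> carrier_vec r"
  shows "real (ortho_dim r V) \<le> R * real (card {i. i < n \<and> (\<exists>v\<in>V. row U i \<bullet> v \<noteq> 0)})"
proof -
  define d where "d = ortho_dim r V"
  obtain W where "ortho_family r V d W" unfolding d_def by (rule ortho_dim_attained)
  then have W: "W \<in> carrier_mat r d" "transpose_mat W * W = 1\<^sub>m d" "\<And>j. j < d \<Longrightarrow> col W j \<in> V"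
    by (auto simp: ortho_family_def)
  define G where "G = U * W"
  have G: "G \<in> carrier_mat n d" using U W by (auto simp: G_def)
  have "transpose_mat G * G = transpose_mat W * transpose_mat U * (U * W)"
    unfolding G_def using transpose_mult[OF U(1) W(1)] by simp
  also have "\<dots> = transpose_mat W * (transpose_mat U * (U * W))"
    using U W by (intro assoc_mult_mat) auto
  also have "transpose_mat U * (U * W) = transpose_mat U * U * W"
    using U W by (intro assoc_mult_mat[symmetric]) auto
  also have "transpose_mat W * (transpose_mat U * U * W) = 1\<^sub>m d" using U W by simp
  finally have GG: "transpose_mat G * G = 1\<^sub>m d" .
  let ?H = "{i. i < n \<and> (\<exists>v\<in>V. row U i \<bullet> v \<noteq> 0)}"
  have "real d = (\<Sum>j<d. (transpose_mat G * G) $$ (j, j))" unfolding GG by simp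
  also have "\<dots> = (\<Sum>j<d. \<Sum>i<n. (G $$ (i, j))\<^sup>2)"
    using G by (intro sum.cong) (auto simp: scalar_prod_def lessThan_atLeast0 power2_eq_square)
  also have "\<dots> = (\<Sum>i<n. \<Sum>j<d. (G $$ (i, j))\<^sup>2)" by (rule sum.swap)
  also have "\<dots> \<le> (\<Sum>i<n. if i \<in> ?H then R else 0)"
  proof (intro sum_mono)
    fix i assume "i \<in> {..<n}"
    then have i: "i < n" by simp
    have u: "row U i \<in> carrier_vec r" using U by (metis row_carrier carrier_matD(2))
    have Gij: "G $$ (i, j) = row U i \<bullet> col W j" if "j < d" for j using that i U W by (simp add: G_def)
    show "(\<Sum>j<d. (G $$ (i, j))\<^sup>2) \<le> (if i \<in> ?H then R else 0)"
    proof (cases "i \<in> ?H")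
      case True
      have "(transpose_mat W *\<^sub>v row U i) $ j = G $$ (i, j)" if "j < d" for j
        using Gij[OF that] that W u comm_scalar_prod[of "row U i" r "col W j"] by simp
      then have "(\<Sum>j<d. (G $$ (i, j))\<^sup>2) = (transpose_mat W *\<^sub>v row U i) \<bullet> (transpose_mat W *\<^sub>v row U i)"
        using W by (simp add: scalar_prod_def[of _ "transpose_mat W *\<^sub>v row U i"] lessThan_atLeast0 power2_eq_square)
      also have "\<dots> \<le> R" using bessel[OF W(1,2) u] R[OF i] by simp
      finally show ?thesis using True by simp
    next
      case False
      then have "G $$ (i, j) = 0" if "j < d" for j using Gij[OF that] W(3)[OF that] i by auto
      then show ?thesis using False by (auto intro!: sum_nonpos)
    qed
  qed
  also have "\<dots> = R * real (card ?H)"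
    by (simp add: sum.If_cases Int_def Collect_conj_eq[symmetric])
  finally show ?thesis by (simp add: d_def)
qed

text \<open>\<open>K\<close> will be the set of clean rows. Sampled rows outside \<open>K\<close>
  impose no condition, which keeps the kernel meaningful for samples that contain unclean
  rows.\<close>

definition sampled_kernel :: "real mat \<Rightarrow> real vec set \<Rightarrow> nat set \<Rightarrow> nat set \<Rightarrow> real vec set" where
  "sampled_kernel U V K S = {v \<in> V. \<forall>i\<in>S \<inter> K. row U i \<bullet> v = 0}"

lemma subspace_sampled_kernel:
  assumes V: "subspace_of r V" and U: "U \<in> carrier_mat n r" and K: "K \<subseteq> {..<n}"
  shows "subspace_of r (sampled_kernel U V K S)"
proof -
  have u: "row U i \<in> carrier_vec r" if "i \<in> K" for i using U by (metis row_carrier carrier_matD(2))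
  have c: "x \<in> carrier_vec r" if "x \<in> V" for x using V that by (auto simp: subspace_of_def)
  show ?thesis
    using V u c unfolding subspace_of_def sampled_kernel_def
    by (auto simp: scalar_prod_add_distrib[of _ r] scalar_prod_smult_distrib[of _ r])
qed

text \<open>Were the dimension unchanged, a maximal orthonormal family of the smaller kernel would
  be maximal in the larger one and reproduce \<open>v\<close>, although all its members are
  orthogonal to row \<open>i\<close>.\<close>

lemma ortho_dim_insert_less:
  assumes V: "subspace_of r V" and U: "U \<in> carrier_mat n r" and K: "K \<subseteq> {..<n}"
    and i: "i \<in> K" and v: "v \<in> sampled_kernel U V K S" "row U i \<bullet> v \<noteq> 0"
  shows "ortho_dim r (sampled_kernel U V K (insert i S)) < ortho_dim r (sampled_kernel U V K S)"
proof (rule ccontr)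
  let ?A = "sampled_kernel U V K S" and ?B = "sampled_kernel U V K (insert i S)"
  assume "\<not> ?thesis"
  moreover have BA: "?B \<subseteq> ?A" by (auto simp: sampled_kernel_def)
  then have "ortho_dim r ?B \<le> ortho_dim r ?A" by (rule ortho_dim_mono)
  ultimately have eq: "ortho_dim r ?B = ortho_dim r ?A" by simp
  obtain W where "ortho_family r ?B (ortho_dim r ?A) W" using ortho_dim_attained[of r ?B] eq by metis
  then have W: "ortho_family r ?A (ortho_dim r ?A) W" and Wc: "W \<in> carrier_mat r (ortho_dim r ?A)"
    and WB: "\<And>j. j < ortho_dim r ?A \<Longrightarrow> col W j \<in> ?B"
    using BA by (auto simp: ortho_family_def)
  have u: "row U i \<in> carrier_vec r" using U by (metis row_carrier carrier_matD(2))
  have vc: "v \<in> carrier_vec r" using v V by (auto simp: sampled_kernel_def subspace_of_def)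
  have rp: "W *\<^sub>v (transpose_mat W *\<^sub>v v) = v"
    using ortho_family_maximal[OF subspace_sampled_kernel[OF V U K] W v(1)] .
  have "transpose_mat W *\<^sub>v row U i = 0\<^sub>v (ortho_dim r ?A)"
  proof (rule eq_vecI)
    fix j assume "j < dim_vec (0\<^sub>v (ortho_dim r ?A) :: real vec)"
    then have j: "j < ortho_dim r ?A" by simp
    have "row U i \<bullet> col W j = 0" using WB[OF j] i by (auto simp: sampled_kernel_def)
    then show "(transpose_mat W *\<^sub>v row U i) $ j = 0\<^sub>v (ortho_dim r ?A) $ j"
      using j Wc u comm_scalar_prod[of "row U i" r "col W j"] by simp
  qed (use Wc in auto)
  moreover have "row U i \<bullet> (W *\<^sub>v (transpose_mat W *\<^sub>v v)) =
      (transpose_mat W *\<^sub>v row U i) \<bullet> (transpose_mat W *\<^sub>v v)"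
    using Wc u vc by (intro scalar_prod_transpose_mult) auto
  ultimately have "row U i \<bullet> v = 0" using rp Wc vc by simp
  then show False using v by simp
qed

text \<open>
  While the rows sampled so far leave a kernel of dimension \<open>d\<close>, at least \<open>d / R\<close> of all rows
  shrink it, because an orthonormal basis of the kernel has total mass \<open>d\<close> over the rows of \<open>U\<close>
  and each row carries at most \<open>R\<close>. So the expected dimension decays geometrically.
\<close>

lemma prob_sampled_kernel_nontrivial_le:
  assumes U: "U \<in> carrier_mat n r" "transpose_mat U * U = 1\<^sub>m r"
    and R: "\<And>i. i < n \<Longrightarrow> row U i \<bullet> row U i \<le> R" "R > 0"
    and V: "subspace_of r V" and d0: "ortho_dim r V \<le> d0"
    and K: "K \<subseteq> {..<n}" "card ({..<n} - K) \<le> b" and l: "l \<le> n"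
  shows "measure_pmf.prob (uniform_subset {..<n} l) {S. \<exists>v\<in>sampled_kernel U V K S. v \<noteq> 0\<^sub>v r}
    \<le> real d0 * exp (real l * (real b - 1 / R) / real n)"
proof -
  define f where "f S = real (ortho_dim r (sampled_kernel U V K S))" for S
  \<comment> \<open>Per dimension at least \<open>1 / R\<close> rows hit the kernel, and at most
    \<open>b\<close> rows lie outside \<open>K\<close>. If the difference is negative, monotonicity
    still gives the rate 0.\<close>
  define c where "c = max 0 (1 / R - real b)"
  have f0: "f S \<ge> 0" for S by (simp add: f_def)
  have step: "(\<Sum>i\<in>{..<n} - S. f (insert i S)) \<le> (real (n - card S) - c) * f S"
    if S: "S \<subseteq> {..<n}" for S
  proof -
    let ?A = "sampled_kernel U V K S"
    define H where "H = {i. i < n \<and> (\<exists>v\<in>?A. row U i \<bullet> v \<noteq> 0)}"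
    have finS: "finite S" using S by (rule finite_subset) simp
    have HS: "H \<inter> K \<subseteq> {..<n} - S" by (auto simp: H_def sampled_kernel_def)
    have mono: "f (insert i S) \<le> f S" for i
      unfolding f_def by (intro of_nat_mono ortho_dim_mono) (auto simp: sampled_kernel_def)
    have hit: "f (insert i S) \<le> f S - 1" if i: "i \<in> H \<inter> K" for i
    proof -
      obtain v where "v \<in> ?A" "row U i \<bullet> v \<noteq> 0" "i \<in> K" using i by (auto simp: H_def)
      then have "ortho_dim r (sampled_kernel U V K (insert i S)) < ortho_dim r ?A"
        using ortho_dim_insert_less[OF V U(1) K(1)] by blast
      then show ?thesis unfolding f_def by linarith
    qed
    have "(\<Sum>i\<in>{..<n} - S. f (insert i S)) \<le> (\<Sum>i\<in>{..<n} - S. f S - (if i \<in> H \<inter> K then 1 else 0))"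
      using hit mono by (intro sum_mono) auto
    also have "\<dots> = real (n - card S) * f S - real (card (({..<n} - S) \<inter> (H \<inter> K)))"
      using S finS
      by (simp add: sum_subtractf sum.If_cases card_Diff_subset) (rule arg_cong[of _ _ card], auto)
    also have "({..<n} - S) \<inter> (H \<inter> K) = H \<inter> K" using HS by auto
    also have "real (n - card S) * f S - real (card (H \<inter> K)) \<le> (real (n - card S) - c) * f S"
    proof -
      have "c * f S \<le> real (card (H \<inter> K))"
      proof (cases "f S = 0 \<or> c = 0")
        case False
        then have f1: "f S \<ge> 1" and c': "c = 1 / R - real b" by (auto simp: f_def c_def max_def split: if_splits)
        have "?A \<subseteq> carrier_vec r" using V by (auto simp: sampled_kernel_def subspace_of_def)
        then have "f S \<le> R * real (card H)"
          unfolding f_def H_def by (intro ortho_dim_le_hits U R)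
        then have "f S / R \<le> real (card H)" using R(2) by (simp add: field_simps)
        also have "card H \<le> card ((H \<inter> K) \<union> ({..<n} - K))"
          by (intro card_mono) (auto simp: H_def)
        then have "real (card H) \<le> real (card (H \<inter> K)) + real b"
          using card_Un_le[of "H \<inter> K" "{..<n} - K"] K(2) by linarith
        \<comment> \<open>A nonzero dimension is at least 1, so the loss \<open>b\<close> can be
          charged per dimension; the decay becomes purely multiplicative.\<close>
        also have "real b \<le> real b * f S" using f1 by (simp add: mult_le_cancel_left1)
        finally show ?thesis unfolding c' by (simp add: algebra_simps)
      qed auto
      then show ?thesis by (simp add: algebra_simps)
    qed
    finally show ?thesis .
  qed
  let ?sub = "{S. S \<subseteq> {..<n} \<and> card S = l}"
  let ?bad = "{S. \<exists>v\<in>sampled_kernel U V K S. v \<noteq> 0\<^sub>v r}"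
  have fin: "finite ?sub" by (rule finite_subset[of _ "Pow {..<n}"]) auto
  have card_sub: "card ?sub = n choose l" using n_subsets[of "{..<n}" l] by simp
  have pos: "n choose l > 0" using l by simp
  then have ne: "?sub \<noteq> {}" using card_sub by (metis card.empty less_irrefl)
  have "real (card (?sub \<inter> ?bad)) = (\<Sum>S\<in>?sub \<inter> ?bad. 1)" by simp
  \<comment> \<open>Markov's inequality in counting form: a nontrivial kernel has dimension at least
    1.\<close>
  also have "\<dots> \<le> (\<Sum>S\<in>?sub \<inter> ?bad. f S)"
  proof (intro sum_mono)
    fix S assume "S \<in> ?sub \<inter> ?bad"
    then obtain v where "v \<in> sampled_kernel U V K S" "v \<noteq> 0\<^sub>v r" by auto
    then have "ortho_dim r (sampled_kernel U V K S) \<ge> 1"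
      using ortho_dim_pos[OF subspace_sampled_kernel[OF V U(1) K(1)]] by blast
    then show "1 \<le> f S" by (simp add: f_def)
  qed
  also have "\<dots> \<le> (\<Sum>S\<in>?sub. f S)" using fin f0 by (intro sum_mono2) auto
  also have "\<dots> \<le> real (n choose l) * f {} * exp (- c * real l / real n)"
  proof (rule sum_subsets_le)
    show "0 \<le> c" by (simp add: c_def)
  qed (use f0 step l in blast)+
  also have "\<dots> \<le> real (n choose l) * (real d0 * exp (real l * (real b - 1 / R) / real n))"
  proof -
    have "- c * real l \<le> real l * (real b - 1 / R)"
    proof -
      have "- c \<le> real b - 1 / R" by (auto simp: c_def)
      then have "- c * real l \<le> (real b - 1 / R) * real l" by (intro mult_right_mono) auto
      then show ?thesis by (simp add: mult.commute)
    qed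
    then have "exp (- c * real l / real n) \<le> exp (real l * (real b - 1 / R) / real n)"
      unfolding exp_le_cancel_iff by (rule divide_right_mono) simp
    moreover have "f {} \<le> real d0" using d0 by (simp add: f_def sampled_kernel_def)
    ultimately show ?thesis unfolding mult.assoc using f0
      by (intro mult_left_mono mult_mono) auto
  qed
  finally have "real (card (?sub \<inter> ?bad)) / real (n choose l)
      \<le> real d0 * exp (real l * (real b - 1 / R) / real n)"
    using pos by (simp add: field_simps)
  then show ?thesis
    unfolding uniform_subset_def by (simp add: measure_pmf_of_set[OF ne fin] card_sub)
qed

section \<open>Block matrices\<close>

lemma hcat_carrier: "A \<in> carrier_mat n a \<Longrightarrow> B \<in> carrier_mat n b \<Longrightarrow> hcat A B \<in> carrier_mat n (a + b)"
  by (auto simp: hcat_def)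

lemma row_hcat:
  assumes "A \<in> carrier_mat n a" "B \<in> carrier_mat n b" "i < n"
  shows "row (hcat A B) i = row A i @\<^sub>v row B i"
  using assms by (intro eq_vecI) (auto simp: hcat_def)

lemma row_hcat_scalar_prod:
  fixes A B :: "real mat"
  assumes "A \<in> carrier_mat n a" "B \<in> carrier_mat n b" "i < n" "v \<in> carrier_vec a" "w \<in> carrier_vec b"
  shows "row (hcat A B) i \<bullet> (v @\<^sub>v w) = row A i \<bullet> v + row B i \<bullet> w"
  using assms unfolding row_hcat[OF assms(1-3)]
  by (intro scalar_prod_append) auto

lemma hcat_mult_transpose_hcat:
  fixes A B C D :: "real mat"
  assumes A: "A \<in> carrier_mat n a" and B: "B \<in> carrier_mat n b"
    and C: "C \<in> carrier_mat m a" and D: "D \<in> carrier_mat m b"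
  shows "hcat A B * transpose_mat (hcat C D) = A * transpose_mat C + B * transpose_mat D"
proof (rule eq_matI)
  fix i j assume "i < dim_row (A * transpose_mat C + B * transpose_mat D)"
    "j < dim_col (A * transpose_mat C + B * transpose_mat D)"
  then have ij: "i < n" "j < m" using B D by auto
  have "(hcat A B * transpose_mat (hcat C D)) $$ (i, j) = row (hcat A B) i \<bullet> row (hcat C D) j"
    using ij hcat_carrier[OF A B] hcat_carrier[OF C D] by simp
  also have "\<dots> = row A i \<bullet> row C j + row B i \<bullet> row D j"
    unfolding row_hcat[OF C D ij(2)] using A B C D ij
    by (intro row_hcat_scalar_prod) auto
  finally show "(hcat A B * transpose_mat (hcat C D)) $$ (i, j) =
      (A * transpose_mat C + B * transpose_mat D) $$ (i, j)"
    using ij A B C D by simp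
qed (use hcat_carrier[OF A B] hcat_carrier[OF C D] B D in auto)

lemma hcat_mult_block_diag:
  fixes A B Z W :: "real mat"
  assumes A: "A \<in> carrier_mat n a" and B: "B \<in> carrier_mat n b"
    and Z: "Z \<in> carrier_mat a a" and W: "W \<in> carrier_mat b b"
  shows "hcat A B * four_block_mat Z (0\<^sub>m a b) (0\<^sub>m b a) W = hcat (A * Z) (B * W)"
proof -
  have AZ: "A * Z \<in> carrier_mat n a" and BW: "B * W \<in> carrier_mat n b" using A B Z W by auto
  \<comment> \<open>Lower blocks without rows turn a concatenation into a four-block matrix, so
    block multiplication applies.\<close>
  have h: "hcat M N = four_block_mat M N (0\<^sub>m 0 a) (0\<^sub>m 0 b)"
    if "M \<in> carrier_mat n a" "N \<in> carrier_mat n b" for M N :: "real mat"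
    using that by (intro eq_matI) (auto simp: hcat_def)
  show ?thesis
    unfolding h[OF A B] h[OF AZ BW] using A B Z W AZ BW
    by (subst mult_four_block_mat[of _ n a _ b _ 0 _ _ a _ b]) (auto intro!: arg_cong4[where f = four_block_mat])
qed

section \<open>Full column rank of concatenated blocks\<close>

lemma append_vec_eq_zero_iff:
  fixes v w :: "real vec"
  assumes "v \<in> carrier_vec a" "w \<in> carrier_vec b"
  shows "v @\<^sub>v w = 0\<^sub>v (a + b) \<longleftrightarrow> v = 0\<^sub>v a \<and> w = 0\<^sub>v b"
proof -
  have "0\<^sub>v (a + b) = (0\<^sub>v a :: real vec) @\<^sub>v 0\<^sub>v b" by (intro eq_vecI) auto
  then show ?thesis using append_vec_eq[OF assms(1), of "0\<^sub>v a" w "0\<^sub>v b"] by simp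
qed

lemma rows_injective_hcat2:
  assumes W: "W1 \<in> carrier_mat n a" "W2 \<in> carrier_mat n b"
  shows "rows_injective (hcat W1 W2) I \<longleftrightarrow>
    (\<forall>v1\<in>carrier_vec a. \<forall>v2\<in>carrier_vec b.
      (\<forall>i\<in>I. i < n \<longrightarrow> row W1 i \<bullet> v1 + row W2 i \<bullet> v2 = 0) \<longrightarrow> v1 = 0\<^sub>v a \<and> v2 = 0\<^sub>v b)"
    (is "_ \<longleftrightarrow> ?R")
proof
  have h: "hcat W1 W2 \<in> carrier_mat n (a + b)" using hcat_carrier W by blast
  note z = append_vec_eq_zero_iff[of _ a _ b]
  {
    assume inj: "rows_injective (hcat W1 W2) I"
    show ?R
    proof (intro ballI impI)
      fix v1 v2 :: "real vec" assume v: "v1 \<in> carrier_vec a" "v2 \<in> carrier_vec b"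
        and 0: "\<forall>i\<in>I. i < n \<longrightarrow> row W1 i \<bullet> v1 + row W2 i \<bullet> v2 = 0"
      have "v1 @\<^sub>v v2 = 0\<^sub>v (a + b)"
        using v 0 row_hcat_scalar_prod[OF W] by (intro rows_injectiveD[OF inj h]) auto
      then show "v1 = 0\<^sub>v a \<and> v2 = 0\<^sub>v b" using z[OF v] by simp
    qed
  next
    assume R: ?R
    show "rows_injective (hcat W1 W2) I"
    proof (rule rows_injectiveI[OF h])
      fix v assume v: "v \<in> carrier_vec (a + b)" "\<And>i. i \<in> I \<Longrightarrow> i < n \<Longrightarrow> row (hcat W1 W2) i \<bullet> v = 0"
      have s: "vec_first v a @\<^sub>v vec_last v b = v" using v by simp
      have "row W1 i \<bullet> vec_first v a + row W2 i \<bullet> vec_last v b = 0" if "i \<in> I" "i < n" for i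
        using v(2)[OF that] row_hcat_scalar_prod[OF W that(2), of "vec_first v a" "vec_last v b"] s by simp
      then have "vec_first v a = 0\<^sub>v a \<and> vec_last v b = 0\<^sub>v b"
        using R[rule_format, of "vec_first v a" "vec_last v b"] by simp
      then show "v = 0\<^sub>v (a + b)" using z[of "vec_first v a" "vec_last v b"] s by simp
    qed
  }
qed

lemma rows_injective_hcat3:
  assumes W: "W1 \<in> carrier_mat n a" "W2 \<in> carrier_mat n b" "W3 \<in> carrier_mat n c"
  shows "rows_injective (hcat (hcat W1 W2) W3) I \<longleftrightarrow>
    (\<forall>v1\<in>carrier_vec a. \<forall>v2\<in>carrier_vec b. \<forall>v3\<in>carrier_vec c.
      (\<forall>i\<in>I. i < n \<longrightarrow> row W1 i \<bullet> v1 + row W2 i \<bullet> v2 + row W3 i \<bullet> v3 = 0) \<longrightarrow>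
        v1 = 0\<^sub>v a \<and> v2 = 0\<^sub>v b \<and> v3 = 0\<^sub>v c)"
    (is "_ \<longleftrightarrow> ?R")
proof
  have h: "hcat W1 W2 \<in> carrier_mat n (a + b)" using hcat_carrier W by blast
  note z = append_vec_eq_zero_iff[of _ a _ b]
  {
    assume inj: "rows_injective (hcat (hcat W1 W2) W3) I"
    show ?R
    proof (intro ballI impI)
      fix v1 v2 v3 :: "real vec"
      assume v: "v1 \<in> carrier_vec a" "v2 \<in> carrier_vec b" "v3 \<in> carrier_vec c"
        and 0: "\<forall>i\<in>I. i < n \<longrightarrow> row W1 i \<bullet> v1 + row W2 i \<bullet> v2 + row W3 i \<bullet> v3 = 0"
      have v12: "v1 @\<^sub>v v2 \<in> carrier_vec (a + b)" using v by auto
      have "\<forall>i\<in>I. i < n \<longrightarrow> row (hcat W1 W2) i \<bullet> (v1 @\<^sub>v v2) + row W3 i \<bullet> v3 = 0"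
        using 0 row_hcat_scalar_prod[OF W(1,2) _ v(1,2)] by simp
      then have "v1 @\<^sub>v v2 = 0\<^sub>v (a + b) \<and> v3 = 0\<^sub>v c"
        using inj v12 v(3) unfolding rows_injective_hcat2[OF h W(3)] by blast
      then show "v1 = 0\<^sub>v a \<and> v2 = 0\<^sub>v b \<and> v3 = 0\<^sub>v c" using z[OF v(1,2)] by simp
    qed
  next
    assume R: ?R
    show "rows_injective (hcat (hcat W1 W2) W3) I"
      unfolding rows_injective_hcat2[OF h W(3)]
    proof (intro ballI impI)
      fix v v3 :: "real vec"
      assume v: "v \<in> carrier_vec (a + b)" "v3 \<in> carrier_vec c"
        and 0: "\<forall>i\<in>I. i < n \<longrightarrow> row (hcat W1 W2) i \<bullet> v + row W3 i \<bullet> v3 = 0"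
      have s: "vec_first v a @\<^sub>v vec_last v b = v" using v by simp
      have "row W1 i \<bullet> vec_first v a + row W2 i \<bullet> vec_last v b + row W3 i \<bullet> v3 = 0" if "i \<in> I" "i < n" for i
        using 0[rule_format, OF that] row_hcat_scalar_prod[OF W(1,2) that(2), of "vec_first v a" "vec_last v b"] s by simp
      then have "vec_first v a = 0\<^sub>v a \<and> vec_last v b = 0\<^sub>v b \<and> v3 = 0\<^sub>v c"
        using R[rule_format, of "vec_first v a" "vec_last v b" v3] v by simp
      then show "v = 0\<^sub>v (a + b) \<and> v3 = 0\<^sub>v c" using z[of "vec_first v a" "vec_last v b"] s by simp
    qed
  }
qed

text \<open>Serves the row side, where the transposed problem exchanges the roles of blocks 2 and
  3.\<close>

lemma rows_injective_hcat3_swap: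
  assumes W: "W1 \<in> carrier_mat n a" "W2 \<in> carrier_mat n b" "W3 \<in> carrier_mat n c"
  shows "rows_injective (hcat (hcat W1 W2) W3) I \<longleftrightarrow> rows_injective (hcat (hcat W1 W3) W2) I"
  unfolding rows_injective_hcat3[OF W] rows_injective_hcat3[OF W(1,3,2)]
  by (auto simp: add.assoc add.left_commute add.commute)

text \<open>
  The rows of the sampled matrix on which the sparse block vanishes already contain the row space
  of \<open>T\<^sup>T\<close>, so a selection of columns spanning the range is injective on \<open>T\<close>.
\<close>

lemma selected_columns_injective:
  assumes P: "P \<in> carrier_mat n r" and P': "P' \<in> carrier_mat n c"
    and T: "T \<in> carrier_mat m r" "injective_mat T" and T': "T' \<in> carrier_mat m c"
    and Zr: "Zr \<in> carrier_mat r r" "det Zr \<noteq> 0" and Zc: "Zc \<in> carrier_mat c c"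
    and A: "A = hcat P P' * four_block_mat Zr (0\<^sub>m r c) (0\<^sub>m c r) Zc * transpose_mat (hcat T T')"
    and ker: "\<And>v. v \<in> sampled_kernel P (carrier_vec r) {i. i < n \<and> row P' i = 0\<^sub>v c} I0 \<Longrightarrow> v = 0\<^sub>v r"
    and S: "srrqr_columns (rows_of A I0) (r + c) J"
  shows "rows_injective T J"
proof (rule rows_injectiveI[OF T(1)])
  fix v assume v: "v \<in> carrier_vec r" "\<And>i. i \<in> J \<Longrightarrow> i < m \<Longrightarrow> row T i \<bullet> v = 0"
  define K where "K = {i. i < n \<and> row P' i = 0\<^sub>v c}"
  define p where "p = card {i. i < n \<and> i \<in> I0}"
  define PZ where "PZ = P * Zr"
  define PZ' where "PZ' = P' * Zc"
  define X where "X = hcat PZ PZ'"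
  define D where "D = transpose_mat (hcat T T')"
  have PZ: "PZ \<in> carrier_mat n r" and PZ': "PZ' \<in> carrier_mat n c"
    using P P' Zr Zc by (auto simp: PZ_def PZ'_def)
  then have X: "X \<in> carrier_mat n (r + c)" unfolding X_def by (rule hcat_carrier)
  have D: "D \<in> carrier_mat (r + c) m" unfolding D_def using hcat_carrier[OF T(1) T'] by simp
  have A': "A = X * D"
    unfolding A X_def D_def PZ_def PZ'_def by (simp only: hcat_mult_block_diag[OF P P' Zr(1) Zc])
  have Aij: "A $$ (i, j) = row PZ i \<bullet> row T j + row PZ' i \<bullet> row T' j" if "i < n" "j < m" for i j
    using that PZ PZ' T T' unfolding A' X_def D_def
    by (subst hcat_mult_transpose_hcat[of _ n r _ c _ m]) auto
  have Ac: "A \<in> carrier_mat n m" unfolding A' using X D by auto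
  define M where "M = rows_of A I0"
  have Mc: "M \<in> carrier_mat p m" using Ac by (auto simp: M_def p_def submatrix_def)
  have Mfac: "M = rows_of X I0 * D" unfolding M_def A' using X D by (intro rows_of_mult) auto
  have XI: "rows_of X I0 \<in> carrier_mat p (r + c)" using X by (auto simp: p_def submatrix_def)
  have pk: "pick I0 s < n" if "s < p" for s using that unfolding p_def by (rule pick_le)
  \<comment> \<open>The sampled part of \<open>P\<close> with unclean rows zeroed; the kernel
    hypothesis says that it has full column rank.\<close>
  define N where "N = mat p r (\<lambda>(s, j). if pick I0 s \<in> K then P $$ (pick I0 s, j) else 0)"
  have N: "N \<in> carrier_mat p r" by (simp add: N_def)
  have rowN: "row N s = (if pick I0 s \<in> K then row P (pick I0 s) else 0\<^sub>v r)" if "s < p" for s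
    using that pk[OF that] P by (intro eq_vecI) (auto simp: N_def)
  have "injective_mat N"
  proof (rule injective_matI[OF N])
    fix x assume x: "x \<in> carrier_vec r" "N *\<^sub>v x = 0\<^sub>v p"
    have "row P i \<bullet> x = 0" if "i \<in> I0 \<inter> K" for i
    proof -
      have i: "i \<in> I0" "i < n" "i \<in> K" using that by (auto simp: K_def)
      have "{a \<in> I0. a < i} \<subset> {i. i < n \<and> i \<in> I0}" using i by auto
      then have s: "card {a\<in>I0. a < i} < p" unfolding p_def by (simp add: psubset_card_mono)
      have "pick I0 (card {a\<in>I0. a < i}) = i" by (rule pick_card_in_set[OF i(1)])
      then show ?thesis
        using arg_cong[OF x(2), of "\<lambda>y. y $ card {a\<in>I0. a < i}"] s N rowN[OF s] i by simp
    qed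
    then have "x \<in> sampled_kernel P (carrier_vec r) K I0" using x by (auto simp: sampled_kernel_def)
    then show "x = 0\<^sub>v r" using ker by (simp add: K_def)
  qed
  then obtain L where L: "L \<in> carrier_mat r p" "L * N = 1\<^sub>m r"
    using injective_left_inverse[OF N] by blast
  obtain H where H: "H \<in> carrier_mat r r" "H * Zr = 1\<^sub>m r"
    using invertible_of_det[OF Zr] by blast
  \<comment> \<open>A vector \<open>u\<close> is built backwards so that the transpose of
    \<open>M\<close> maps it to \<open>T\<close> times \<open>v\<close>: \<open>t\<close> undoes
    \<open>Zr\<close>, then \<open>y\<close> undoes \<open>N\<close>.\<close>
  define t where "t = transpose_mat H *\<^sub>v v"
  have t: "t \<in> carrier_vec r" using H v by (auto simp: t_def)
  have "transpose_mat Zr * transpose_mat H = 1\<^sub>m r" using transpose_mult[OF H(1) Zr(1)] H(2) by simp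
  moreover have "transpose_mat Zr *\<^sub>v t = (transpose_mat Zr * transpose_mat H) *\<^sub>v v"
    unfolding t_def using H Zr v by (intro assoc_mult_mat_vec[symmetric]) auto
  ultimately have Zt: "transpose_mat Zr *\<^sub>v t = v" using v by simp
  define y where "y = transpose_mat L *\<^sub>v t"
  have y: "y \<in> carrier_vec p" using L t by (auto simp: y_def)
  have "transpose_mat N * transpose_mat L = 1\<^sub>m r" using transpose_mult[OF L(1) N] L(2) by simp
  moreover have "transpose_mat N *\<^sub>v y = (transpose_mat N * transpose_mat L) *\<^sub>v t"
    unfolding y_def using L N t by (intro assoc_mult_mat_vec[symmetric]) auto
  ultimately have Ny: "transpose_mat N *\<^sub>v y = t" using t by simp
  \<comment> \<open>\<open>N\<close> does not see the entries of \<open>y\<close> at unclean samples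
    but \<open>M\<close> would, so they are zeroed. At clean samples the sparse part of
    \<open>M\<close> vanishes.\<close>
  define u where "u = vec p (\<lambda>s. if pick I0 s \<in> K then y $ s else 0)"
  have u: "u \<in> carrier_vec p" by (simp add: u_def)
  define N' where "N' = N * Zr * transpose_mat T"
  have NZ: "N * Zr \<in> carrier_mat p r" and N': "N' \<in> carrier_mat p m"
    using N Zr T by (auto simp: N'_def)
  have Mu: "M $$ (s, j) * u $ s = N' $$ (s, j) * y $ s" if "s < p" "j < m" for s j
  proof -
    let ?i = "pick I0 s"
    have M1: "M $$ (s, j) = row PZ ?i \<bullet> row T j + row PZ' ?i \<bullet> row T' j"
      using that Ac Aij[OF pk[OF that(1)] that(2)]
      by (simp add: M_def submatrix_def p_def pick_UNIV)
    have N1: "N' $$ (s, j) = row (N * Zr) s \<bullet> row T j"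
      unfolding N'_def using that N T by (subst index_mult_mat(1)) auto
    have rNZ: "row (N * Zr) s = vec r (\<lambda>j. row N s \<bullet> col Zr j)"
      using that N Zr by (intro eq_vecI) auto
    show ?thesis
    proof (cases "?i \<in> K")
      case True
      have "row (N * Zr) s = row PZ ?i"
        unfolding rNZ PZ_def using True rowN[OF that(1)] pk[OF that(1)] P Zr by (intro eq_vecI) auto
      moreover have "row PZ' ?i = 0\<^sub>v c"
        using True pk[OF that(1)] P' Zc by (intro eq_vecI) (auto simp: PZ'_def K_def)
      ultimately show ?thesis using True that M1 N1 T' by (simp add: u_def)
    next
      case False
      have "row (N * Zr) s = 0\<^sub>v r"
        unfolding rNZ using False rowN[OF that(1)] Zr by (intro eq_vecI) auto
      then show ?thesis using False that N1 T by (simp add: u_def)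
    qed
  qed
  have "transpose_mat M *\<^sub>v u = transpose_mat N' *\<^sub>v y"
  proof (rule eq_vecI)
    fix j assume "j < dim_vec (transpose_mat N' *\<^sub>v y)"
    then have "j < m" using N' by simp
    then show "(transpose_mat M *\<^sub>v u) $ j = (transpose_mat N' *\<^sub>v y) $ j"
      using Mc N' u y Mu by (auto simp: scalar_prod_def intro!: sum.cong)
  qed (use Mc N' in auto)
  also have "transpose_mat N' = T * transpose_mat (N * Zr)"
    unfolding N'_def using NZ T by (subst transpose_mult[of _ p r _ m]) auto
  also have "\<dots> *\<^sub>v y = T *\<^sub>v (transpose_mat (N * Zr) *\<^sub>v y)"
    using NZ T y by (intro assoc_mult_mat_vec) auto
  also have "transpose_mat (N * Zr) *\<^sub>v y = transpose_mat Zr *\<^sub>v (transpose_mat N *\<^sub>v y)"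
    using N Zr y by (simp add: transpose_mult[of _ p r _ r] assoc_mult_mat_vec[of _ r r _ p])
  finally have MuT: "transpose_mat M *\<^sub>v u = T *\<^sub>v v" using Ny Zt by simp
  \<comment> \<open>Entry \<open>j\<close> of this vector is row \<open>j\<close> of
    \<open>T\<close> against \<open>v\<close>, which is 0 for selected \<open>j\<close>. So
    \<open>u\<close> is orthogonal to the selected columns, hence to all.\<close>
  have "transpose_mat M *\<^sub>v u = 0\<^sub>v m"
  proof (rule srrqr_columns_span[OF Mc S[folded M_def] XI D Mfac u])
    fix j assume j: "j \<in> J" "j < m"
    have "col M j \<bullet> u = (transpose_mat M *\<^sub>v u) $ j" using j Mc by simp
    also have "\<dots> = row T j \<bullet> v" unfolding MuT using j T by simp
    finally show "col M j \<bullet> u = 0" using v(2)[OF j] by simp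
  qed
  then show "v = 0\<^sub>v r" using injective_matD[OF T(2,1) v(1)] MuT by simp
qed

text \<open>The kernel left by the rows in \<open>J\<close>, projected to the two blocks that are not sparse.\<close>

definition residual_kernel :: "nat \<Rightarrow> nat \<Rightarrow> nat \<Rightarrow> nat \<Rightarrow> real mat \<Rightarrow> real mat \<Rightarrow> real mat \<Rightarrow> nat set \<Rightarrow> real vec set" where
  "residual_kernel m a b c W1 W2 W3 J = {w \<in> carrier_vec (a + c). \<exists>v\<in>carrier_vec b.
     \<forall>j\<in>J. j < m \<longrightarrow> row (hcat W1 W3) j \<bullet> w + row W2 j \<bullet> v = 0}"

lemma subspace_residual_kernel:
  assumes W: "W1 \<in> carrier_mat m a" "W2 \<in> carrier_mat m b" "W3 \<in> carrier_mat m c"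
  shows "subspace_of (a + c) (residual_kernel m a b c W1 W2 W3 J)"
proof -
  have h: "row (hcat W1 W3) j \<in> carrier_vec (a + c)" if "j < m" for j
    using hcat_carrier[OF W(1,3)] by (metis row_carrier carrier_matD(2))
  have r2: "row W2 j \<in> carrier_vec b" if "j < m" for j using W by (metis row_carrier carrier_matD(2))
  show ?thesis
    unfolding subspace_of_def
  proof (intro conjI ballI allI)
    show "residual_kernel m a b c W1 W2 W3 J \<subseteq> carrier_vec (a + c)" by (auto simp: residual_kernel_def)
    show "0\<^sub>v (a + c) \<in> residual_kernel m a b c W1 W2 W3 J"
      using h r2 by (auto simp: residual_kernel_def intro!: bexI[of _ "0\<^sub>v b"])
    fix x assume "x \<in> residual_kernel m a b c W1 W2 W3 J"
    then obtain v where x: "x \<in> carrier_vec (a + c)" "v \<in> carrier_vec b"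
      "\<forall>j\<in>J. j < m \<longrightarrow> row (hcat W1 W3) j \<bullet> x + row W2 j \<bullet> v = 0" by (auto simp: residual_kernel_def)
    show "s \<cdot>\<^sub>v x \<in> residual_kernel m a b c W1 W2 W3 J" for s
    proof -
      have "row (hcat W1 W3) j \<bullet> (s \<cdot>\<^sub>v x) + row W2 j \<bullet> (s \<cdot>\<^sub>v v) = s * (row (hcat W1 W3) j \<bullet> x + row W2 j \<bullet> v)"
        if "j < m" for j
        using h[OF that] r2[OF that] x
        by (simp add: scalar_prod_smult_distrib[of _ "a + c"] scalar_prod_smult_distrib[of _ b] distrib_left)
      then show ?thesis using x by (auto simp: residual_kernel_def intro!: bexI[of _ "s \<cdot>\<^sub>v v"])
    qed
    fix x' assume "x' \<in> residual_kernel m a b c W1 W2 W3 J"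
    then obtain v' where x': "x' \<in> carrier_vec (a + c)" "v' \<in> carrier_vec b"
      "\<forall>j\<in>J. j < m \<longrightarrow> row (hcat W1 W3) j \<bullet> x' + row W2 j \<bullet> v' = 0" by (auto simp: residual_kernel_def)
    have "row (hcat W1 W3) j \<bullet> (x + x') + row W2 j \<bullet> (v + v') =
      (row (hcat W1 W3) j \<bullet> x + row W2 j \<bullet> v) + (row (hcat W1 W3) j \<bullet> x' + row W2 j \<bullet> v')"
      if "j < m" for j
      using h[OF that] r2[OF that] x x'
      by (simp add: scalar_prod_add_distrib[of _ "a + c"] scalar_prod_add_distrib[of _ b])
    then show "x + x' \<in> residual_kernel m a b c W1 W2 W3 J"
      using x x' by (auto simp: residual_kernel_def intro!: bexI[of _ "v + v'"])
  qed
qed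

text \<open>A residual vector whose last \<open>c\<close> coordinates vanish is zero, by injectivity
  of the first two blocks on \<open>J\<close>. More than \<open>c\<close> orthonormal vectors would
  have a nonzero combination of that kind.\<close>

lemma ortho_dim_residual_kernel_le:
  assumes W: "W1 \<in> carrier_mat m a" "W2 \<in> carrier_mat m b" "W3 \<in> carrier_mat m c"
    and inj: "rows_injective (hcat W1 W2) J"
  shows "ortho_dim (a + c) (residual_kernel m a b c W1 W2 W3 J) \<le> c"
proof (rule ccontr)
  let ?V = "residual_kernel m a b c W1 W2 W3 J"
  define d where "d = ortho_dim (a + c) ?V"
  assume "\<not> ?thesis"
  then have "c < d" by (simp add: d_def)
  obtain F where F': "ortho_family (a + c) ?V d F" unfolding d_def by (rule ortho_dim_attained)
  then have F: "F \<in> carrier_mat (a + c) d" "\<forall>j<d. col F j \<in> ?V" by (auto simp: ortho_family_def)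
  define N where "N = mat c d (\<lambda>(i, j). F $$ (a + i, j))"
  have N: "N \<in> carrier_mat c d" by (simp add: N_def)
  obtain x where x: "x \<in> carrier_vec d" "x \<noteq> 0\<^sub>v d" "N *\<^sub>v x = 0\<^sub>v c"
    using wide_mat_kernel[OF N \<open>c < d\<close>] by blast
  define w where "w = F *\<^sub>v x"
  have wV: "w \<in> ?V" unfolding w_def by (rule subspace_mult_vec[OF subspace_residual_kernel[OF W] F x(1)])
  then obtain v where w: "w \<in> carrier_vec (a + c)" and v: "v \<in> carrier_vec b"
    "\<forall>j\<in>J. j < m \<longrightarrow> row (hcat W1 W3) j \<bullet> w + row W2 j \<bullet> v = 0" by (auto simp: residual_kernel_def)
  have s: "vec_first w a @\<^sub>v vec_last w c = w" using w by simp
  have l0: "vec_last w c = 0\<^sub>v c"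
  proof (rule eq_vecI)
    fix i assume "i < dim_vec (0\<^sub>v c :: real vec)"
    then have i: "i < c" by simp
    have "row N i = row F (a + i)" using i F by (intro eq_vecI) (auto simp: N_def)
    then have "w $ (a + i) = (N *\<^sub>v x) $ i" using i F N by (simp add: w_def)
    then show "vec_last w c $ i = 0\<^sub>v c $ i" using x(3) i w by (simp add: vec_last_def)
  qed simp
  have "row W1 j \<bullet> vec_first w a + row W2 j \<bullet> v = 0" if "j \<in> J" "j < m" for j
  proof -
    have r3: "row W3 j \<in> carrier_vec c" using W by (metis row_carrier carrier_matD(2))
    have "row (hcat W1 W3) j \<bullet> w = row W1 j \<bullet> vec_first w a"
      using row_hcat_scalar_prod[OF W(1,3) that(2), of "vec_first w a" "vec_last w c"] s l0 r3 by simp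
    then show ?thesis using v that by auto
  qed
  then have "vec_first w a = 0\<^sub>v a"
    using inj v(1) unfolding rows_injective_hcat2[OF W(1,2)] by (meson vec_first_carrier)
  then have "w = 0\<^sub>v a @\<^sub>v 0\<^sub>v c" using s l0 by simp
  then have "F *\<^sub>v x = 0\<^sub>v (a + c)" unfolding w_def[symmetric] by (intro eq_vecI) auto
  then show False using injective_matD[OF ortho_family_injective[OF F'] F(1) x(1)] x(2) by simp
qed

text \<open>For a vector killed by all rows in the union, the \<open>W1\<close> and
  \<open>W3\<close> parts lie in the residual kernel, and the rows in \<open>J'\<close> with
  vanishing \<open>W2\<close> see only these parts, so they are zero. The rows in \<open>J\<close>
  then remove the \<open>W2\<close> part.\<close>

lemma rows_injective_union:
  assumes W: "W1 \<in> carrier_mat m a" "W2 \<in> carrier_mat m b" "W3 \<in> carrier_mat m c"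
    and inj: "rows_injective (hcat W1 W2) J"
    and ker: "\<And>w. w \<in> sampled_kernel (hcat W1 W3) (residual_kernel m a b c W1 W2 W3 J)
      {j. j < m \<and> row W2 j = 0\<^sub>v b} J' \<Longrightarrow> w = 0\<^sub>v (a + c)"
  shows "rows_injective (hcat (hcat W1 W2) W3) (J \<union> J')"
  unfolding rows_injective_hcat3[OF W]
proof (intro ballI impI)
  fix v1 v2 v3 :: "real vec"
  assume v: "v1 \<in> carrier_vec a" "v2 \<in> carrier_vec b" "v3 \<in> carrier_vec c"
    and 0: "\<forall>i\<in>J \<union> J'. i < m \<longrightarrow> row W1 i \<bullet> v1 + row W2 i \<bullet> v2 + row W3 i \<bullet> v3 = 0"
  have rw: "row (hcat W1 W3) j \<bullet> (v1 @\<^sub>v v3) = row W1 j \<bullet> v1 + row W3 j \<bullet> v3" if "j < m" for j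
    by (rule row_hcat_scalar_prod[OF W(1,3) that v(1,3)])
  have "v1 @\<^sub>v v3 \<in> residual_kernel m a b c W1 W2 W3 J"
    using v 0 rw by (auto simp: residual_kernel_def intro!: bexI[of _ v2])
  moreover have "row (hcat W1 W3) j \<bullet> (v1 @\<^sub>v v3) = 0"
    if "j \<in> J' \<inter> {j. j < m \<and> row W2 j = 0\<^sub>v b}" for j
    using that 0 rw[of j] v(2) by auto
  ultimately have "v1 @\<^sub>v v3 = 0\<^sub>v (a + c)" by (intro ker) (auto simp: sampled_kernel_def)
  then have v13: "v1 = 0\<^sub>v a" "v3 = 0\<^sub>v c" using append_vec_eq_zero_iff[OF v(1,3)] by auto
  have "row W1 i \<bullet> v1 + row W2 i \<bullet> v2 = 0" if "i \<in> J" "i < m" for i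
  proof -
    have "row W3 i \<in> carrier_vec c" using W by (metis row_carrier carrier_matD(2))
    then show ?thesis using 0[rule_format, of i] that v13(2) by simp
  qed
  then have "v2 = 0\<^sub>v b" using inj v unfolding rows_injective_hcat2[OF W(1,2)] by blast
  then show "v1 = 0\<^sub>v a \<and> v2 = 0\<^sub>v b \<and> v3 = 0\<^sub>v c" using v13 by simp
qed

section \<open>The three-block factorization\<close>

lemma block_diag_product:
  fixes X1 X2 X3 Y1 Y2 Y3 Z1 Z2 Z3 :: "real mat"
  assumes X: "X1 \<in> carrier_mat n k1" "X2 \<in> carrier_mat n k2" "X3 \<in> carrier_mat n k3"
    and Y: "Y1 \<in> carrier_mat m k1" "Y2 \<in> carrier_mat m k2" "Y3 \<in> carrier_mat m k3"
    and Z: "Z1 \<in> carrier_mat k1 k1" "Z2 \<in> carrier_mat k2 k2" "Z3 \<in> carrier_mat k3 k3"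
  shows "hcat (hcat X1 X2) X3 *
      four_block_mat (four_block_mat Z1 (0\<^sub>m k1 k2) (0\<^sub>m k2 k1) Z2) (0\<^sub>m (k1 + k2) k3) (0\<^sub>m k3 (k1 + k2)) Z3 *
      transpose_mat (hcat (hcat Y1 Y2) Y3) =
    X1 * Z1 * transpose_mat Y1 + X2 * Z2 * transpose_mat Y2 + X3 * Z3 * transpose_mat Y3"
proof -
  have X12: "hcat X1 X2 \<in> carrier_mat n (k1 + k2)" and Y12: "hcat Y1 Y2 \<in> carrier_mat m (k1 + k2)"
    using hcat_carrier X Y by blast+
  have Z12: "four_block_mat Z1 (0\<^sub>m k1 k2) (0\<^sub>m k2 k1) Z2 \<in> carrier_mat (k1 + k2) (k1 + k2)"
    using Z by auto
  have XZ: "X1 * Z1 \<in> carrier_mat n k1" "X2 * Z2 \<in> carrier_mat n k2" "X3 * Z3 \<in> carrier_mat n k3"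
    using X Z by auto
  show ?thesis
    unfolding hcat_mult_block_diag[OF X12 X(3) Z12 Z(3)] hcat_mult_block_diag[OF X(1,2) Z(1,2)]
      hcat_mult_transpose_hcat[OF hcat_carrier[OF XZ(1,2)] XZ(3) Y12 Y(3)]
      hcat_mult_transpose_hcat[OF XZ(1,2) Y(1,2)] ..
qed

lemma injective_mat_imp_rows_injective:
  assumes M: "M \<in> carrier_mat n k" and inj: "injective_mat M"
  shows "rows_injective M UNIV"
proof (rule rows_injectiveI[OF M])
  fix v assume v: "v \<in> carrier_vec k" "\<And>i. i \<in> UNIV \<Longrightarrow> i < n \<Longrightarrow> row M i \<bullet> v = 0"
  then have "M *\<^sub>v v = 0\<^sub>v n" using M by (intro eq_vecI) auto
  then show "v = 0\<^sub>v k" by (rule injective_matD[OF inj M v(1)])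
qed

lemma rows_injective_hcat_left:
  assumes W: "W1 \<in> carrier_mat n a" "W2 \<in> carrier_mat n b" and inj: "rows_injective (hcat W1 W2) I"
  shows "rows_injective W1 I"
proof (rule rows_injectiveI[OF W(1)])
  fix v assume v: "v \<in> carrier_vec a" "\<And>i. i \<in> I \<Longrightarrow> i < n \<Longrightarrow> row W1 i \<bullet> v = 0"
  have "row W2 i \<bullet> 0\<^sub>v b = 0" if "i < n" for i
    using W(2) that by (metis row_carrier carrier_matD(2) scalar_prod_right_zero)
  then show "v = 0\<^sub>v a"
    using inj[unfolded rows_injective_hcat2[OF W], rule_format, OF v(1), of "0\<^sub>v b"] v by simp
qed

text \<open>Blocks 1 and 2 are merged and block 3 is the sparse one. \<open>A\<close> enters as a
  sum of three products so that the transpose, with blocks 2 and 3 exchanged, is covered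
  too.\<close>

lemma selected_columns_injective3:
  fixes X1 X2 X3 Y1 Y2 Y3 Z1 Z2 Z3 :: "real mat"
  assumes X: "X1 \<in> carrier_mat n k1" "X2 \<in> carrier_mat n k2" "X3 \<in> carrier_mat n k3"
    and Y: "Y1 \<in> carrier_mat m k1" "Y2 \<in> carrier_mat m k2" "Y3 \<in> carrier_mat m k3"
    and Z: "Z1 \<in> carrier_mat k1 k1" "Z2 \<in> carrier_mat k2 k2" "Z3 \<in> carrier_mat k3 k3"
    and d: "det Z1 \<noteq> 0" "det Z2 \<noteq> 0"
    and A: "A = X1 * Z1 * transpose_mat Y1 + X2 * Z2 * transpose_mat Y2 + X3 * Z3 * transpose_mat Y3"
    and inj: "injective_mat (hcat (hcat Y1 Y2) Y3)"
    and ker: "\<And>v. v \<in> sampled_kernel (hcat X1 X2) (carrier_vec (k1 + k2))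
      {i. i < n \<and> row X3 i = 0\<^sub>v k3} I0 \<Longrightarrow> v = 0\<^sub>v (k1 + k2)"
    and S: "srrqr_columns (rows_of A I0) (k1 + k2 + k3) J"
  shows "rows_injective (hcat Y1 Y2) J"
proof -
  let ?Z12 = "four_block_mat Z1 (0\<^sub>m k1 k2) (0\<^sub>m k2 k1) Z2"
  have X12: "hcat X1 X2 \<in> carrier_mat n (k1 + k2)" and Y12: "hcat Y1 Y2 \<in> carrier_mat m (k1 + k2)"
    using hcat_carrier X Y by blast+
  have Z12: "?Z12 \<in> carrier_mat (k1 + k2) (k1 + k2)" using Z by auto
  have dZ: "det ?Z12 \<noteq> 0"
    using det_four_block_mat_upper_right_zero[OF Z(1) refl _ Z(2), of "0\<^sub>m k2 k1"] d by simp
  have "rows_injective (hcat (hcat Y1 Y2) Y3) UNIV"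
    using inj hcat_carrier[OF Y12 Y(3)] by (intro injective_mat_imp_rows_injective)
  then have "injective_mat (hcat Y1 Y2)"
    using rows_injective_hcat_left[OF Y12 Y(3)] rows_injective_imp_injective[OF Y12] by blast
  then show ?thesis
    using A block_diag_product[OF X Y Z] ker S
    by (intro selected_columns_injective[OF X12 X(3) Y12 _ Y(3) Z12 dZ Z(3)]) auto
qed

lemma ortho_dim_carrier_le: "ortho_dim r (carrier_vec r) \<le> r"
  using ortho_dim_attained[of r "carrier_vec r"] ortho_family_dim_le by metis

lemma subspace_carrier: "subspace_of r (carrier_vec r)"
  by (auto simp: subspace_of_def)

lemma set_pmf_uniform_subset:
  assumes "l \<le> n" "S \<in> set_pmf (uniform_subset {..<n} l)"
  shows "S \<subseteq> {..<n}" "card S = l"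
proof -
  let ?sub = "{S. S \<subseteq> {..<n} \<and> card S = l}"
  have "finite ?sub" by (rule finite_subset[of _ "Pow {..<n}"]) auto
  \<comment> \<open>Nonemptiness matters, since \<open>pmf_of_set\<close> is unspecified on the
    empty set.\<close>
  moreover have "{..<l} \<in> ?sub" using assms(1) by auto
  ultimately have "set_pmf (uniform_subset {..<n} l) = ?sub"
    unfolding uniform_subset_def by (intro set_pmf_of_set) blast+
  then show "S \<subseteq> {..<n}" "card S = l" using assms(2) by auto
qed

lemma dim_row_rows_of:
  assumes "I \<subseteq> {..<dim_row A}"
  shows "dim_row (rows_of A I) = card I"
  unfolding dim_submatrix using assms by (intro arg_cong[of _ _ card]) auto

section \<open>Failure probability\<close>

lemma max_norm_ge:
  assumes "i < dim_row M" "j < dim_col M"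
  shows "\<bar>M $$ (i, j)\<bar> \<le> max_norm M"
proof -
  have "M $$ (i, j) \<in> elements_mat M" using assms by (auto simp: elements_mat_def intro!: bexI[of _ i])
  moreover have "finite (elements_mat M)" by (simp add: elements_mat_def)
  ultimately show ?thesis unfolding max_norm_def by (intro Max_ge) auto
qed

text \<open>Every squared entry is at most \<mu> / n. A column of unit length then forces \<mu> to
  be at least 1, and a row has only \<open>r\<close> entries.\<close>

lemma orthonormal_coherent_bounds:
  assumes U: "U \<in> carrier_mat n r" "orthonormal_cols U" "coherent \<mu> U" and r: "r > 0"
  shows "n > 0" "\<mu> \<ge> 1" "\<And>i. i < n \<Longrightarrow> row U i \<bullet> row U i \<le> real r * \<mu> / real n"
proof -
  have \<mu>: "\<mu> = real n * (max_norm U)\<^sup>2" using U r by (auto simp: coherent_def)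
  have UU: "transpose_mat U * U = 1\<^sub>m r" using U by (auto simp: orthonormal_cols_def)
  have sq: "(U $$ (i, j))\<^sup>2 \<le> (max_norm U)\<^sup>2" if "i < n" "j < r" for i j
    using max_norm_ge[of i U j] U that by (simp add: abs_le_square_iff[symmetric])
  have "injective_mat U" using U UU by (intro left_inverse_imp_injective[of U n r "transpose_mat U"]) auto
  then show n: "n > 0" using injective_mat_dim_le[OF _ U(1)] r by simp
  have "1 = (transpose_mat U * U) $$ (0, 0)" unfolding UU using r by simp
  also have "\<dots> = (\<Sum>i<n. (U $$ (i, 0))\<^sup>2)"
    using U r by (simp add: scalar_prod_def lessThan_atLeast0 power2_eq_square)
  also have "\<dots> \<le> (\<Sum>i<n. (max_norm U)\<^sup>2)" using sq r by (intro sum_mono) auto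
  also have "\<dots> = \<mu>" by (simp add: \<mu>)
  finally show "\<mu> \<ge> 1" .
  fix i assume i: "i < n"
  have "row U i \<bullet> row U i = (\<Sum>j<r. (U $$ (i, j))\<^sup>2)"
    using U i by (simp add: scalar_prod_def lessThan_atLeast0 power2_eq_square)
  also have "\<dots> \<le> (\<Sum>j<r. (max_norm U)\<^sup>2)" using sq i by (intro sum_mono) auto
  also have "\<dots> = real r * \<mu> / real n" using n by (simp add: \<mu>)
  finally show "row U i \<bullet> row U i \<le> real r * \<mu> / real n" .
qed

lemma prob_coherent_sampling_le:
  assumes U: "U \<in> carrier_mat n r" "orthonormal_cols U" "coherent \<mu> U"
    and N: "N \<in> carrier_mat n c" "\<forall>j<c. card {i. i < n \<and> N $$ (i, j) \<noteq> 0} \<le> \<beta>"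
    and V: "subspace_of r V" "ortho_dim r V \<le> d"
    and l: "l \<le> n" "real l = \<alpha> * \<mu> * real k" and "r \<le> k" "\<alpha> > 0"
  shows "measure_pmf.prob (uniform_subset {..<n} l)
      {S. \<exists>v\<in>sampled_kernel U V {i. i < n \<and> row N i = 0\<^sub>v c} S. v \<noteq> 0\<^sub>v r}
    \<le> real d * exp (real \<beta> * real l * real c / real n - \<alpha>)"
proof (cases "r = 0")
  case True
  \<comment> \<open>Without columns coherence says nothing about \<mu>, but there is no kernel
    either.\<close>
  have "v = 0\<^sub>v r" if "v \<in> V" for v
  proof (rule eq_vecI)
    have "v \<in> carrier_vec r" using that V by (auto simp: subspace_of_def)
    then show "dim_vec v = dim_vec (0\<^sub>v r)" by simp
  qed (simp add: True)
  then have "{S. \<exists>v\<in>sampled_kernel U V {i. i < n \<and> row N i = 0\<^sub>v c} S. v \<noteq> 0\<^sub>v r} = {}"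
    by (auto simp: sampled_kernel_def)
  then show ?thesis by simp
next
  case False
  then have r: "r > 0" by simp
  note b = orthonormal_coherent_bounds[OF U r]
  define K where "K = {i. i < n \<and> row N i = 0\<^sub>v c}"
  define R where "R = real r * \<mu> / real n"
  have R: "R > 0" using b r by (auto simp: R_def)
  \<comment> \<open>Unclean rows lie in the union of the \<open>c\<close> column supports, each of
    size at most \<beta>.\<close>
  have "{..<n} - K \<subseteq> (\<Union>j<c. {i. i < n \<and> N $$ (i, j) \<noteq> 0})"
  proof
    fix i assume i: "i \<in> {..<n} - K"
    show "i \<in> (\<Union>j<c. {i. i < n \<and> N $$ (i, j) \<noteq> 0})"
    proof (rule ccontr)
      assume "\<not> ?thesis"
      then have "row N i = 0\<^sub>v c" using i N by (intro eq_vecI) auto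
      then show False using i by (simp add: K_def)
    qed
  qed
  then have "card ({..<n} - K) \<le> card (\<Union>j<c. {i. i < n \<and> N $$ (i, j) \<noteq> 0})"
    by (intro card_mono) auto
  also have "\<dots> \<le> (\<Sum>j<c. card {i. i < n \<and> N $$ (i, j) \<noteq> 0})" by (rule card_UN_le) simp
  also have "\<dots> \<le> (\<Sum>j<c. \<beta>)" using N by (intro sum_mono) auto
  finally have cK: "card ({..<n} - K) \<le> \<beta> * c" by (simp add: mult.commute)
  have "measure_pmf.prob (uniform_subset {..<n} l) {S. \<exists>v\<in>sampled_kernel U V K S. v \<noteq> 0\<^sub>v r}
      \<le> real d * exp (real l * (real (\<beta> * c) - 1 / R) / real n)"
  proof (rule prob_sampled_kernel_nontrivial_le)
    show "transpose_mat U * U = 1\<^sub>m r" using U by (auto simp: orthonormal_cols_def)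
    show "row U i \<bullet> row U i \<le> R" if "i < n" for i using b(3)[OF that] by (simp add: R_def)
    show "K \<subseteq> {..<n}" by (auto simp: K_def)
  qed (use U R V cK l in auto)
  also have "\<dots> \<le> real d * exp (real \<beta> * real l * real c / real n - \<alpha>)"
  proof (intro mult_left_mono)
    \<comment> \<open>The sample size is tuned to the row bound: l / (n R) equals \<alpha> k / r,
      which is at least \<alpha>.\<close>
    have "\<alpha> * 1 \<le> \<alpha> * (real k / real r)"
      using \<open>r \<le> k\<close> r \<open>\<alpha> > 0\<close> by (intro mult_left_mono) auto
    moreover have "real l * (real (\<beta> * c) - 1 / R) / real n =
        real \<beta> * real l * real c / real n - \<alpha> * (real k / real r)"
      using b r by (simp add: R_def l(2) field_simps)
    ultimately show "exp (real l * (real (\<beta> * c) - 1 / R) / real n)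
        \<le> exp (real \<beta> * real l * real c / real n - \<alpha>)" by simp
  qed simp
  finally show ?thesis by (simp add: K_def)
qed

text \<open>A union bound over one draw: inside \<open>G\<close> failure is bounded by 1, outside by
  \<open>\<delta>\<close>. Applied along the program it adds up the phases, and the bad set of a
  later draw may depend on earlier ones.\<close>

lemma prob_bind_pmf_le:
  assumes "\<delta> \<ge> 0" and le: "\<And>x. x \<in> set_pmf p \<Longrightarrow> x \<notin> G \<Longrightarrow> measure_pmf.prob (f x) B \<le> \<delta>"
  shows "measure_pmf.prob (bind_pmf p f) B \<le> measure_pmf.prob p G + \<delta>"
proof -
  have "emeasure (bind_pmf p f) B = (\<integral>\<^sup>+x. emeasure (f x) B \<partial>measure_pmf p)" by simp
  also have "\<dots> \<le> (\<integral>\<^sup>+x. indicator G x + ennreal \<delta> \<partial>measure_pmf p)"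
  proof (rule nn_integral_mono_AE, rule AE_pmfI)
    fix x assume x: "x \<in> set_pmf p"
    show "emeasure (f x) B \<le> indicator G x + ennreal \<delta>"
    proof (cases "x \<in> G")
      case True
      have "emeasure (f x) B \<le> 1" by (rule measure_pmf.emeasure_le_1)
      then show ?thesis using True by (simp add: add_increasing2)
    next
      case False
      then show ?thesis using le[OF x False] assms(1)
        by (simp add: measure_pmf.emeasure_eq_measure ennreal_leI)
    qed
  qed
  also have "\<dots> = emeasure p G + ennreal \<delta>"
    by (subst nn_integral_add) (auto simp: measure_pmf.emeasure_space_1)
  also have "\<dots> = ennreal (measure_pmf.prob p G + \<delta>)"
    using assms(1) by (simp add: measure_pmf.emeasure_eq_measure)
  finally show ?thesis
    using assms(1) by (simp add: measure_pmf.emeasure_eq_measure del: ennreal_plus)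
qed

lemma prob_bind_pmf_le_const:
  assumes "\<delta> \<ge> 0" and "\<And>x. x \<in> set_pmf p \<Longrightarrow> measure_pmf.prob (f x) B \<le> \<delta>"
  shows "measure_pmf.prob (bind_pmf p f) B \<le> \<delta>"
  using prob_bind_pmf_le[of \<delta> p "{}" f B] assms by simp

text \<open>\<open>G1\<close> and \<open>G3\<close> are the bad outcomes for \<open>I0\<close> and \<open>J0\<close>; \<open>G2 Ja\<close> and \<open>G4 Ia\<close> are
  those for \<open>Jb\<close> and \<open>Ib\<close>.\<close>

lemma prob_rand_srrqr_le:
  assumes G1: "measure_pmf.prob (uniform_subset {..<dim_row A} l0) G1 \<le> p1"
    and G2: "\<And>I0 Ja. I0 \<in> set_pmf (uniform_subset {..<dim_row A} l0) \<Longrightarrow> I0 \<notin> G1 \<Longrightarrow>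
      Ja \<in> set_pmf (sel (rows_of A I0) la) \<Longrightarrow>
      measure_pmf.prob (uniform_subset {..<dim_col A} lb) (G2 Ja) \<le> p2"
    and G3: "measure_pmf.prob (uniform_subset {..<dim_col A} l0) G3 \<le> p3"
    and G4: "\<And>J0 Ia. J0 \<in> set_pmf (uniform_subset {..<dim_col A} l0) \<Longrightarrow> J0 \<notin> G3 \<Longrightarrow>
      Ia \<in> set_pmf (sel (transpose_mat (cols_of A J0)) la) \<Longrightarrow>
      measure_pmf.prob (uniform_subset {..<dim_row A} lb) (G4 Ia) \<le> p4"
    and good: "\<And>I0 Ja Jb J0 Ia Ib. I0 \<in> set_pmf (uniform_subset {..<dim_row A} l0) \<Longrightarrow> I0 \<notin> G1 \<Longrightarrow>
      Ja \<in> set_pmf (sel (rows_of A I0) la) \<Longrightarrow> Jb \<notin> G2 Ja \<Longrightarrow>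
      J0 \<in> set_pmf (uniform_subset {..<dim_col A} l0) \<Longrightarrow> J0 \<notin> G3 \<Longrightarrow>
      Ia \<in> set_pmf (sel (transpose_mat (cols_of A J0)) la) \<Longrightarrow> Ib \<notin> G4 Ia \<Longrightarrow>
      (Ia \<union> Ib, Ja \<union> Jb) \<in> E"
    and nonneg: "p2 \<ge> 0" "p3 \<ge> 0" "p4 \<ge> 0"
  shows "measure_pmf.prob (rand_srrqr sel A l0 la lb) (- E) \<le> p1 + (p2 + (p3 + p4))"
  unfolding rand_srrqr_def
proof (rule order.trans[OF prob_bind_pmf_le add_right_mono[OF G1]])
  fix I0 assume I0: "I0 \<in> set_pmf (uniform_subset {..<dim_row A} l0)" "I0 \<notin> G1"
  show "measure_pmf.prob (do { Ja \<leftarrow> sel (rows_of A I0) la;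
          Jb \<leftarrow> uniform_subset {..<dim_col A} lb;
          J0 \<leftarrow> uniform_subset {..<dim_col A} l0;
          Ia \<leftarrow> sel (transpose_mat (cols_of A J0)) la;
          Ib \<leftarrow> uniform_subset {..<dim_row A} lb;
          return_pmf (Ia \<union> Ib, Ja \<union> Jb) }) (- E) \<le> p2 + (p3 + p4)"
  proof (rule prob_bind_pmf_le_const)
    fix Ja assume Ja: "Ja \<in> set_pmf (sel (rows_of A I0) la)"
    show "measure_pmf.prob (do { Jb \<leftarrow> uniform_subset {..<dim_col A} lb;
          J0 \<leftarrow> uniform_subset {..<dim_col A} l0;
          Ia \<leftarrow> sel (transpose_mat (cols_of A J0)) la;
          Ib \<leftarrow> uniform_subset {..<dim_row A} lb;
          return_pmf (Ia \<union> Ib, Ja \<union> Jb) }) (- E) \<le> p2 + (p3 + p4)"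
    proof (rule order.trans[OF prob_bind_pmf_le add_right_mono[OF G2[OF I0 Ja]]])
      fix Jb assume Jb: "Jb \<notin> G2 Ja"
      show "measure_pmf.prob (do { J0 \<leftarrow> uniform_subset {..<dim_col A} l0;
          Ia \<leftarrow> sel (transpose_mat (cols_of A J0)) la;
          Ib \<leftarrow> uniform_subset {..<dim_row A} lb;
          return_pmf (Ia \<union> Ib, Ja \<union> Jb) }) (- E) \<le> p3 + p4"
      proof (rule order.trans[OF prob_bind_pmf_le add_right_mono[OF G3]])
        fix J0 assume J0: "J0 \<in> set_pmf (uniform_subset {..<dim_col A} l0)" "J0 \<notin> G3"
        show "measure_pmf.prob (do { Ia \<leftarrow> sel (transpose_mat (cols_of A J0)) la;
          Ib \<leftarrow> uniform_subset {..<dim_row A} lb;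
          return_pmf (Ia \<union> Ib, Ja \<union> Jb) }) (- E) \<le> p4"
        proof (rule prob_bind_pmf_le_const)
          fix Ia assume Ia: "Ia \<in> set_pmf (sel (transpose_mat (cols_of A J0)) la)"
          \<comment> \<open>Nothing is random after this draw, so the continuation contributes
            0.\<close>
          have "measure_pmf.prob (do { Ib \<leftarrow> uniform_subset {..<dim_row A} lb;
            return_pmf (Ia \<union> Ib, Ja \<union> Jb) }) (- E) \<le> p4 + 0"
          proof (rule order.trans[OF prob_bind_pmf_le add_right_mono[OF G4[OF J0 Ia]]])
            fix Ib assume "Ib \<notin> G4 Ia"
            then have "(Ia \<union> Ib, Ja \<union> Jb) \<in> E" using good[OF I0 Ja Jb J0 Ia] by blast
            then show "measure_pmf.prob (return_pmf (Ia \<union> Ib, Ja \<union> Jb)) (- E) \<le> 0"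
              by (simp add: measure_return_pmf)
          qed simp
          then show "measure_pmf.prob (do { Ib \<leftarrow> uniform_subset {..<dim_row A} lb;
            return_pmf (Ia \<union> Ib, Ja \<union> Jb) }) (- E) \<le> p4" by simp
        qed (use nonneg in simp)
      qed (use nonneg in simp)
    qed (use nonneg in simp)
  qed (use nonneg in simp)
qed (use nonneg in simp)

text \<open>Trades the factor exp x for the additive term \<open>t\<close>. From (1 - x) exp x <= 1
  follows (1 - x) (exp x - 1) <= x, and \<open>x\<close> is at most both \<open>s\<close> and
  \<open>t\<close>; the factor 1 - s in the bound on \<open>a\<close> thus absorbs the growth, and 2
  k e <= 1 absorbs the rest.\<close>

lemma mult_exp_le_add:
  fixes a x s e t :: real
  assumes "0 \<le> x" "x \<le> t * s" "0 \<le> s" "s \<le> 1" "t \<le> 1" "a \<le> 2 * k * (1 - s)" "2 * k * e \<le> 1" "e \<ge> 0" "k \<ge> 0"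
    "t \<ge> 0"
  shows "a * exp x * e \<le> a * e + t"
proof -
  have xs: "x \<le> s" using assms mult_right_mono[of t 1 s] by simp
  have xt: "x \<le> t" using assms mult_left_mono[of s 1 t] by simp
  have "1 \<le> exp x" using assms by simp
  have "(1 - x) * exp x \<le> exp (- x) * exp x"
    using exp_ge_add_one_self[of "- x"] by (intro mult_right_mono) auto
  then have 1: "(1 - x) * exp x \<le> 1" by (simp add: exp_minus)
  have "(1 - s) * (exp x - 1) \<le> (1 - x) * (exp x - 1)" using xs assms by (intro mult_right_mono) auto
  also have "\<dots> \<le> x" using 1 by (simp add: algebra_simps)
  finally have 2: "(1 - s) * (exp x - 1) \<le> t" using xt by simp
  have "a * (exp x - 1) * e \<le> 2 * k * (1 - s) * (exp x - 1) * e"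
    using assms by (intro mult_right_mono) auto
  also have "\<dots> = (2 * k * e) * ((1 - s) * (exp x - 1))" by simp
  also have "\<dots> \<le> 1 * t" using assms 2 by (intro mult_mono) auto
  finally show ?thesis by (simp add: algebra_simps)
qed

theorem theorem13:
  fixes A X Y Z X1 X2 X3 Y1 Y2 Y3 Z1 Z2 Z3 :: "real mat"
    and n m k k1 k2 k3 \<beta> l0 la lb :: nat
    and \<alpha> \<mu> :: real
    and sel :: "real mat \<Rightarrow> nat \<Rightarrow> nat set pmf"
  assumes "k1 + k2 + k3 = k"
    and "X1 \<in> carrier_mat n k1" "X2 \<in> carrier_mat n k2" "X3 \<in> carrier_mat n k3"
    and "Y1 \<in> carrier_mat m k1" "Y2 \<in> carrier_mat m k2" "Y3 \<in> carrier_mat m k3"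
    and "Z1 \<in> carrier_mat k1 k1" "Z2 \<in> carrier_mat k2 k2" "Z3 \<in> carrier_mat k3 k3"
    and "X = hcat (hcat X1 X2) X3" "Y = hcat (hcat Y1 Y2) Y3"
    and "Z = diag_block_mat [Z1, Z2, Z3]"
    and "mrank X = k" "mrank Y = k" "mrank Z = k"
    and "A = X * Z * transpose_mat Y"
    and "orthonormal_cols (hcat X1 X2)" "coherent \<mu> (hcat X1 X2)"
    and "orthonormal_cols (hcat Y1 Y3)" "coherent \<mu> (hcat Y1 Y3)"
    and "\<forall>j<k3. card {i. i < n \<and> X3 $$ (i, j) \<noteq> 0} \<le> \<beta>"
    and "\<forall>j<k2. card {i. i < m \<and> Y2 $$ (i, j) \<noteq> 0} \<le> \<beta>"
    and "\<alpha> > 0"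
    and "real l0 = \<alpha> * \<mu> * real k" "la = k" "real lb = \<alpha> * \<mu> * real k"
    and "l0 \<le> n" "l0 \<le> m" "lb \<le> n" "lb \<le> m"
    and "srrqr_implementation sel"
  defines "l \<equiv> real (Max {l0, la, lb})"
  shows "measure_pmf.prob (rand_srrqr sel A l0 la lb)
      {(I, J). A = cols_of A J * pinv (cols_of A J) * A * pinv (rows_of A I) * rows_of A I}
    \<ge> 1 - (real \<beta> * l * real k / real n + real \<beta> * l * real k / real m
             + 2 * real k * exp (- \<alpha>))"
proof -
  note X = assms(2-4) and Y = assms(5-7) and Zi = assms(8-10)
  note XYZ = assms(11-13) and rk = assms(14-16) and A = assms(17)
  note k = assms(1) and U = assms(18,19) and V = assms(20,21) and sp = assms(22,23)
  note \<alpha> = assms(24) and l0 = assms(25) and la = assms(26) and lb = assms(27)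
  note ln = assms(28,29) and sel = assms(32)
  have X12: "hcat X1 X2 \<in> carrier_mat n (k1 + k2)" and Y12: "hcat Y1 Y2 \<in> carrier_mat m (k1 + k2)"
    and X13: "hcat X1 X3 \<in> carrier_mat n (k1 + k3)" and Y13: "hcat Y1 Y3 \<in> carrier_mat m (k1 + k3)"
    using hcat_carrier X Y by blast+
  have Xc: "X \<in> carrier_mat n k" and Yc: "Y \<in> carrier_mat m k"
    using hcat_carrier[OF X12 X(3)] hcat_carrier[OF Y12 Y(3)] XYZ k by auto
  define Z12 where "Z12 = four_block_mat Z1 (0\<^sub>m k1 k2) (0\<^sub>m k2 k1) Z2"
  have Z12: "Z12 \<in> carrier_mat (k1 + k2) (k1 + k2)" using Zi by (auto simp: Z12_def)
  have "diag_block_mat [Z1, Z2] = Z12"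
    using Zi diag_block_mat_last[of "[Z1]" Z2] by (simp add: Z12_def Let_def del: diag_block_mat.simps)
  then have Z: "Z = four_block_mat Z12 (0\<^sub>m (k1 + k2) k3) (0\<^sub>m k3 (k1 + k2)) Z3"
    using diag_block_mat_last[of "[Z1, Z2]" Z3] Z12 Zi XYZ(3) by (simp add: Let_def del: diag_block_mat.simps)
  have Zc: "Z \<in> carrier_mat k k"
    using four_block_carrier_mat[OF Z12 Zi(3)] k by (simp add: Z)
  have Xi: "injective_mat X" and Yi: "injective_mat Y" and Zinj: "injective_mat Z"
    using mrank_eq_dim_col_imp_injective Xc Yc Zc rk by auto
  have Am: "A \<in> carrier_mat n m" using A Xc Zc Yc by auto
  have good: "A = cols_of A J * pinv (cols_of A J) * A * pinv (rows_of A I) * rows_of A I"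
    if "rows_injective X I" "rows_injective Y J" for I J
    by (rule skeleton_exact[OF Xc Zc Zinj Yc A that])
  let ?E = "{(I, J). A = cols_of A J * pinv (cols_of A J) * A * pinv (rows_of A I) * rows_of A I}"
  define x where "x = real \<beta> * l * real k / real n"
  define y where "y = real \<beta> * l * real k / real m"
  define e where "e = exp (- \<alpha>)"
  have l_ge: "real l0 \<le> l" "real lb \<le> l" unfolding l_def by auto
  have nonneg: "x \<ge> 0" "y \<ge> 0" "e \<ge> 0" using l_ge by (auto simp: x_def y_def e_def)
  \<comment> \<open>For \<open>k = 0\<close> every pair of index sets works, and if one of the three
    terms reaches 1 the claimed bound is at most 0. Otherwise all three are below 1, as
    \<open>mult_exp_le_add\<close> requires.\<close>
  show ?thesis
  proof (cases "k = 0 \<or> x \<ge> 1 \<or> y \<ge> 1 \<or> 2 * real k * e \<ge> 1")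
    case True
    then show ?thesis
    proof (cases "k = 0")
      case True
      have "rows_injective M I" if "M \<in> carrier_mat s k" for M I s
      proof (rule rows_injectiveI[OF that])
        fix v :: "real vec" assume "v \<in> carrier_vec k"
        then show "v = 0\<^sub>v k" using True by (intro eq_vecI) auto
      qed
      then have "?E = UNIV" using good Xc Yc by auto
      then show ?thesis using True by simp
    next
      case False
      then have "1 \<le> x + y + 2 * real k * e"
        using True nonneg by (auto intro: add_increasing add_increasing2)
      then have "1 - (x + y + 2 * real k * e) \<le> 0" by simp
      then show ?thesis unfolding x_def y_def e_def by (rule order.trans) simp
    qed
  next
    case False
    then have k0: "k > 0" and x1: "x < 1" and y1: "y < 1" and e1: "2 * real k * e < 1" by auto
    have \<mu>1: "\<mu> \<ge> 1"
    \<comment> \<open>One of the two coherent matrices may have no columns, but not both when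
      \<open>k > 0\<close>.\<close>
    proof (cases "k1 + k2 > 0")
      case True
      then show ?thesis using orthonormal_coherent_bounds(2)[OF X12 U] by simp
    next
      case False
      then have "k1 + k3 > 0" using k k0 by simp
      then show ?thesis using orthonormal_coherent_bounds(2)[OF Y13 V] by simp
    qed
    text \<open>A factorization of rank \<open>k\<close> exists: \<open>l0 < k\<close> forces \<open>\<alpha> < 1\<close>, where the bound is
      vacuous for \<open>k \<ge> 2\<close>.\<close>
    have kl0: "k \<le> l0"
    proof (rule ccontr)
      assume "\<not> ?thesis"
      then have "real l0 < real k" by simp
      then have "\<alpha> * \<mu> * real k < 1 * real k" using l0 by linarith
      then have am: "\<alpha> * \<mu> < 1" by (rule mult_right_less_imp_less) simp
      have "\<alpha> * 1 \<le> \<alpha> * \<mu>" using \<mu>1 \<alpha> by (intro mult_left_mono) auto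
      then have "exp (- 1) \<le> e" using am by (simp add: e_def)
      \<comment> \<open>A crude constant suffices: 2 k / 3 < 1 leaves only \<open>k = 1\<close>,
        where \<open>l0 < k\<close> would make \<open>l0\<close> zero although \<alpha> \<mu> k is
        positive.\<close>
      moreover have "exp (- 1) \<ge> (1 / 3 :: real)"
        using exp_le by (simp add: exp_minus field_simps)
      ultimately have "1 / 3 \<le> e" by linarith
      then have "2 * real k * (1 / 3) \<le> 2 * real k * e" by (intro mult_left_mono) auto
      then have "real k < 3 / 2" using e1 by linarith
      then have "k = 1" using k0 by linarith
      then have "l0 = 0" using \<open>\<not> k \<le> l0\<close> by simp
      then show False using l0 \<open>k = 1\<close> \<alpha> \<mu>1 by simp
    qed
    have km: "k \<le> m" and kn: "k \<le> n"
      using injective_mat_dim_le[OF Yi Yc] injective_mat_dim_le[OF Xi Xc] by auto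
    have "det Z = det Z12 * det Z3"
      unfolding Z using Z12 Zi by (intro det_four_block_mat_upper_right_zero[of _ "k1 + k2" _ k3]) auto
    moreover have "det Z12 = det Z1 * det Z2"
      unfolding Z12_def using Zi by (intro det_four_block_mat_upper_right_zero[of _ k1 _ k2]) auto
    moreover have "det Z \<noteq> 0" using injective_square_iff_det[OF Zc] Zinj by simp
    ultimately have dZ: "det Z1 \<noteq> 0" "det Z2 \<noteq> 0" "det Z3 \<noteq> 0" by auto
    have A3: "A = X1 * Z1 * transpose_mat Y1 + X2 * Z2 * transpose_mat Y2 + X3 * Z3 * transpose_mat Y3"
      unfolding A XYZ(1,2) Z Z12_def by (rule block_diag_product[OF X Y Zi])
    have tr: "transpose_mat (P * W * transpose_mat Q) = Q * transpose_mat W * transpose_mat P"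
      if "P \<in> carrier_mat n s" "W \<in> carrier_mat s s" "Q \<in> carrier_mat m s" for P W Q :: "real mat" and s
    proof -
      have "transpose_mat (P * W * transpose_mat Q) = Q * transpose_mat (P * W)"
        using that by (subst transpose_mult[of _ n s _ m]) auto
      also have "transpose_mat (P * W) = transpose_mat W * transpose_mat P"
        by (rule transpose_mult[OF that(1,2)])
      also have "Q * (transpose_mat W * transpose_mat P) = Q * transpose_mat W * transpose_mat P"
        using that by (intro assoc_mult_mat[symmetric]) auto
      finally show ?thesis .
    qed
    have "transpose_mat A = Y1 * transpose_mat Z1 * transpose_mat X1 + Y2 * transpose_mat Z2 * transpose_mat X2
        + Y3 * transpose_mat Z3 * transpose_mat X3"
      unfolding A3 using X Y Zi tr[OF X(1) Zi(1) Y(1)] tr[OF X(2) Zi(2) Y(2)] tr[OF X(3) Zi(3) Y(3)]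
      by (simp add: transpose_add[of _ n m])
    \<comment> \<open>In the transpose the coherent block is \<open>[Y1 Y3]\<close> and the sparse
      one is \<open>Y2\<close>, so blocks 2 and 3 trade places.\<close>
    also have "\<dots> = Y1 * transpose_mat Z1 * transpose_mat X1 + Y3 * transpose_mat Z3 * transpose_mat X3
        + Y2 * transpose_mat Z2 * transpose_mat X2"
      using X Y Zi by (intro eq_matI) auto
    finally have At: "transpose_mat A = Y1 * transpose_mat Z1 * transpose_mat X1
        + Y3 * transpose_mat Z3 * transpose_mat X3 + Y2 * transpose_mat Z2 * transpose_mat X2" .
    have sel': "srrqr_columns M k S"
      if "S \<in> set_pmf (sel M k)" "k \<le> dim_row M" "k \<le> dim_col M" for M S
      using sel that unfolding srrqr_implementation_def by auto
    define KX where "KX = {i. i < n \<and> row X3 i = 0\<^sub>v k3}"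
    define KY where "KY = {j. j < m \<and> row Y2 j = 0\<^sub>v k2}"
    define VY where "VY = residual_kernel m k1 k2 k3 Y1 Y2 Y3"
    \<comment> \<open>Since \<open>Ia\<close> is already injective on \<open>[X1 X3]\<close>, this
      residual kernel in the coordinates of \<open>[X1 X2]\<close> has dimension at most
      \<open>k2\<close>.\<close>
    define VX where "VX = residual_kernel n k1 k3 k2 X1 X3 X2"
    define G1 where "G1 = {S. \<exists>v\<in>sampled_kernel (hcat X1 X2) (carrier_vec (k1 + k2)) KX S. v \<noteq> 0\<^sub>v (k1 + k2)}"
    define G2 where "G2 Ja = {S. \<exists>v\<in>sampled_kernel (hcat Y1 Y3) (VY Ja) KY S. v \<noteq> 0\<^sub>v (k1 + k3)}" for Ja
    define G3 where "G3 = {S. \<exists>v\<in>sampled_kernel (hcat Y1 Y3) (carrier_vec (k1 + k3)) KY S. v \<noteq> 0\<^sub>v (k1 + k3)}"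
    define G4 where "G4 Ia = {S. \<exists>v\<in>sampled_kernel (hcat X1 X2) (VX Ia) KX S. v \<noteq> 0\<^sub>v (k1 + k2)}" for Ia
    \<comment> \<open>Counts only the \<open>k3\<close> sparse columns, in contrast to
      \<open>x\<close>, which has \<open>k\<close>; the ratio is needed at the end.\<close>
    define x' where "x' = real \<beta> * real l0 * real k3 / real n"
    define y' where "y' = real \<beta> * real l0 * real k2 / real m"
    have lbl0: "lb = l0" using l0 lb by simp
    have Ja: "rows_injective (hcat Y1 Y2) Ja"
      if I0: "I0 \<in> set_pmf (uniform_subset {..<n} l0)" "I0 \<notin> G1"
        and J: "Ja \<in> set_pmf (sel (rows_of A I0) la)" for I0 Ja
    proof (rule selected_columns_injective3[OF X Y Zi dZ(1,2) A3])
      show "injective_mat (hcat (hcat Y1 Y2) Y3)" using Yi XYZ by simp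
      show "v = 0\<^sub>v (k1 + k2)" if "v \<in> sampled_kernel (hcat X1 X2) (carrier_vec (k1 + k2))
          {i. i < n \<and> row X3 i = 0\<^sub>v k3} I0" for v
        using that I0(2) by (auto simp: G1_def KX_def)
      have "dim_row (rows_of A I0) = l0" "dim_col (rows_of A I0) = m"
        using dim_row_rows_of[of I0 A] set_pmf_uniform_subset[OF ln(1) I0(1)] Am
        by (auto simp: dim_submatrix)
      then show "srrqr_columns (rows_of A I0) (k1 + k2 + k3) Ja"
        using sel'[of Ja "rows_of A I0"] J la k kl0 km by simp
    qed
    have Ia: "rows_injective (hcat X1 X3) Ia"
      if J0: "J0 \<in> set_pmf (uniform_subset {..<m} l0)" "J0 \<notin> G3"
        and I: "Ia \<in> set_pmf (sel (transpose_mat (cols_of A J0)) la)" for J0 Ia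
    proof (rule selected_columns_injective3[OF Y(1,3,2) X(1,3,2) _ _ _ _ _ At])
      have "injective_mat (hcat (hcat X1 X2) X3)" using Xi XYZ by simp
      then have "rows_injective (hcat (hcat X1 X2) X3) UNIV"
        using hcat_carrier[OF X12 X(3)] by (intro injective_mat_imp_rows_injective)
      then show "injective_mat (hcat (hcat X1 X3) X2)"
        unfolding rows_injective_hcat3_swap[OF X]
        by (rule rows_injective_imp_injective[OF hcat_carrier[OF X13 X(2)]])
      show "v = 0\<^sub>v (k1 + k3)" if "v \<in> sampled_kernel (hcat Y1 Y3) (carrier_vec (k1 + k3))
          {i. i < m \<and> row Y2 i = 0\<^sub>v k2} J0" for v
        using that J0(2) by (auto simp: G3_def KY_def)
      have tc: "transpose_mat (cols_of A J0) = rows_of (transpose_mat A) J0"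
        by (simp add: cols_of_eq_transpose)
      have "dim_row (rows_of (transpose_mat A) J0) = l0" "dim_col (rows_of (transpose_mat A) J0) = n"
        using dim_row_rows_of[of J0 "transpose_mat A"] set_pmf_uniform_subset[OF ln(2) J0(1)] Am
        by (auto simp: dim_submatrix)
      then show "srrqr_columns (rows_of (transpose_mat A) J0) (k1 + k3 + k2) Ia"
        using sel'[of Ia "rows_of (transpose_mat A) J0"] I la k kl0 kn tc by (simp add: ac_simps)
    qed (use Zi dZ det_transpose[OF Zi(1)] det_transpose[OF Zi(3)] in auto)
    have "measure_pmf.prob (rand_srrqr sel A l0 la lb) (- ?E) \<le>
        real (k1 + k2) * exp (x' - \<alpha>) + (real k3 * exp (y' - \<alpha>) +
        (real (k1 + k3) * exp (y' - \<alpha>) + real k2 * exp (x' - \<alpha>)))"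
    proof (rule prob_rand_srrqr_le)
      have Ad: "dim_row A = n" "dim_col A = m" using Am by auto
      show "measure_pmf.prob (uniform_subset {..<dim_row A} l0) G1 \<le> real (k1 + k2) * exp (x' - \<alpha>)"
        unfolding Ad G1_def KX_def x'_def
        using X12 U X(3) sp(1) ln(1) l0 k \<alpha>
        by (intro prob_coherent_sampling_le[where k = k] subspace_carrier ortho_dim_carrier_le) auto
      show "measure_pmf.prob (uniform_subset {..<dim_col A} l0) G3 \<le> real (k1 + k3) * exp (y' - \<alpha>)"
        unfolding Ad G3_def KY_def y'_def
        using Y13 V Y(2) sp(2) ln(2) l0 k \<alpha>
        by (intro prob_coherent_sampling_le[where k = k] subspace_carrier ortho_dim_carrier_le) auto
      show "measure_pmf.prob (uniform_subset {..<dim_col A} lb) (G2 Ja) \<le> real k3 * exp (y' - \<alpha>)"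
        if "I0 \<in> set_pmf (uniform_subset {..<dim_row A} l0)" "I0 \<notin> G1"
          "Ja \<in> set_pmf (sel (rows_of A I0) la)" for I0 Ja
        unfolding Ad G2_def KY_def y'_def VY_def lbl0
        using Y13 V Y sp(2) ln(2) l0 k \<alpha> Ja[of I0 Ja] that Ad
        by (intro prob_coherent_sampling_le[where k = k] subspace_residual_kernel ortho_dim_residual_kernel_le) auto
      show "measure_pmf.prob (uniform_subset {..<dim_row A} lb) (G4 Ia) \<le> real k2 * exp (x' - \<alpha>)"
        if "J0 \<in> set_pmf (uniform_subset {..<dim_col A} l0)" "J0 \<notin> G3"
          "Ia \<in> set_pmf (sel (transpose_mat (cols_of A J0)) la)" for J0 Ia
        unfolding Ad G4_def KX_def x'_def VX_def lbl0
        using X12 U X sp(1) ln(1) l0 k \<alpha> Ia[of J0 Ia] that Ad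
        by (intro prob_coherent_sampling_le[where k = k] subspace_residual_kernel ortho_dim_residual_kernel_le) auto
      fix I0 Ja Jb J0 Ia Ib
      assume I0: "I0 \<in> set_pmf (uniform_subset {..<dim_row A} l0)" "I0 \<notin> G1"
        and Ja': "Ja \<in> set_pmf (sel (rows_of A I0) la)" and Jb: "Jb \<notin> G2 Ja"
        and J0: "J0 \<in> set_pmf (uniform_subset {..<dim_col A} l0)" "J0 \<notin> G3"
        and Ia': "Ia \<in> set_pmf (sel (transpose_mat (cols_of A J0)) la)" and Ib: "Ib \<notin> G4 Ia"
      have "rows_injective (hcat (hcat Y1 Y2) Y3) (Ja \<union> Jb)"
      proof (rule rows_injective_union[OF Y])
        show "rows_injective (hcat Y1 Y2) Ja" using Ja[OF _ I0(2) Ja'] I0(1) Ad by simp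
      qed (use Jb in \<open>auto simp: G2_def VY_def KY_def\<close>)
      then have "rows_injective Y (Ja \<union> Jb)" using XYZ by simp
      moreover have "rows_injective (hcat (hcat X1 X3) X2) (Ia \<union> Ib)"
      proof (rule rows_injective_union[OF X(1,3,2)])
        show "rows_injective (hcat X1 X3) Ia" using Ia[OF _ J0(2) Ia'] J0(1) Ad by simp
      qed (use Ib in \<open>auto simp: G4_def VX_def KX_def\<close>)
      then have "rows_injective X (Ia \<union> Ib)"
        unfolding XYZ(1) rows_injective_hcat3_swap[OF X] .
      ultimately show "(Ia \<union> Ib, Ja \<union> Jb) \<in> ?E" using good by blast
    qed auto
    \<comment> \<open>Phases with the same exponent merge: \<open>I0\<close> and \<open>Ib\<close>
      give (k1 + k2) + k2, \<open>J0\<close> and \<open>Jb\<close> give (k1 + k3) + k3.\<close>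
    also have "\<dots> = real (k1 + 2 * k2) * exp x' * e + real (k1 + 2 * k3) * exp y' * e"
      by (simp add: e_def exp_diff exp_minus field_simps)
    also have "\<dots> \<le> (real (k1 + 2 * k2) * e + x) + (real (k1 + 2 * k3) * e + y)"
    proof (intro add_mono)
      have sc: "real \<beta> * real l0 * real s / real q \<le> real \<beta> * l * real k / real q * (real s / real k)" for s q
      proof -
        have "real \<beta> * real l0 * real s / real q \<le> real \<beta> * l * real s / real q"
          using l_ge(1) by (intro divide_right_mono mult_right_mono mult_left_mono) auto
        then show ?thesis using k0 by simp
      qed
      show "real (k1 + 2 * k2) * exp x' * e \<le> real (k1 + 2 * k2) * e + x"
      \<comment> \<open>\<open>s\<close> is the share of sparse columns in \<open>X\<close>. The
        coefficient is at most 2 (k1 + k2), which is 2 k (1 - s).\<close>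
      proof (rule mult_exp_le_add[where k = "real k" and s = "real k3 / real k"])
        show "x' \<le> x * (real k3 / real k)" unfolding x'_def x_def by (rule sc)
        show "real (k1 + 2 * k2) \<le> 2 * real k * (1 - real k3 / real k)"
          using k k0 by (simp add: algebra_simps)
      qed (use nonneg x1 e1 k k0 in \<open>auto simp: x'_def\<close>)
      show "real (k1 + 2 * k3) * exp y' * e \<le> real (k1 + 2 * k3) * e + y"
      proof (rule mult_exp_le_add[where k = "real k" and s = "real k2 / real k"])
        show "y' \<le> y * (real k2 / real k)" unfolding y'_def y_def by (rule sc)
        show "real (k1 + 2 * k3) \<le> 2 * real k * (1 - real k2 / real k)"
          using k k0 by (simp add: algebra_simps)
      qed (use nonneg y1 e1 k k0 in \<open>auto simp: y'_def\<close>)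
    qed
    also have "\<dots> = x + y + 2 * real k * e" using k by (simp add: algebra_simps flip: k)
    finally have "measure_pmf.prob (rand_srrqr sel A l0 la lb) (- ?E) \<le> x + y + 2 * real k * e" .
    moreover have "measure_pmf.prob (rand_srrqr sel A l0 la lb) (- ?E) =
        1 - measure_pmf.prob (rand_srrqr sel A l0 la lb) ?E"
      using measure_pmf.prob_compl[of ?E "rand_srrqr sel A l0 la lb"] by (simp add: Compl_eq_Diff_UNIV)
    ultimately show ?thesis unfolding x_def y_def e_def by linarith
  qed
qed

end
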